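(* Let $n\ge2$ and let $\mathcal{F} \subseteq \Pi$ be a set of equivalence classes (under reparameterization) of paths $[0,1]\to\mathbb{R}^n$. Consider the following property: $(\dagger)$ for each $\varepsilon > 0$, there is a positive integer $N$ such that for every $[\gamma] \in \mathcal{F}$, there is no collection of more than $N$ pairwise disjoint subintervals of $[0,1]$ whose images under $\gamma$ have diameters $\geq \varepsilon$. If $\mathcal{F}$ satisfies $(\dagger)$, then the family of standard parameterizations $\widetilde{\mathcal{F}} = \{\widetilde{\gamma}: [\gamma] \in \mathcal{F}\}$ is equicontinuous. Conversely, if an equicontinuous family can be formed by choosing parameterizations of all the paths in $\mathcal{F}$ (i.e. by choosing a representative of each class in $\mathcal{F}$), then $\mathcal{F}$ satisfies the property $(\dagger)$.
   Context: A path is a continuous map $\gamma:[0,1]\to\mathbb{R}^n$. Reparameterization: $\gamma_1\approx\gamma_2$ if there are non-decreasing onto maps $m_1,m_2:[0,1]\to[0,1]$ such that $\gamma_i$ is constant on each fiber $m_i^{-1}(s)$, $s\in[0,1]$, for $i=1,2$, and $\gamma_1\circ m_1^{-1}=\gamma_2\circ m_2^{-1}$. This is an equivalence relation on paths; $[\gamma]$ is the class of $\gamma$ and $\Pi$ is the set of all classes. Definition of $\mathsf{len}=\mathsf{len}_n$ for a path $\gamma:[a,b]\to\mathbb{R}^n$ ($a\le b$). For a unit vector $u\in \mathbb{S}^{n-1}$, $x\in[0,1]$, $\mu\in(0,1]$ and $j\in\mathbb{Z}$ put $S_j^{x,u,\mu}=\{z\in\mathbb{R}^n: \mu(j+x)\le\langle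 z,u\rangle\le\mu(j+1+x)\}$, and for $A\subset\mathbb{R}^n$ put $\|A\|_u=\mathrm{diam}\{\langle z,u\rangle: z\in A\}$. Let $C_0,C_1,C_2,\ldots$ (a finite or infinite list) enumerate all connected components $C$ of the sets $\gamma^{-1}(S_j^{x,u,\mu})$, $j\in\mathbb{Z}$, for which $\|\gamma(C)\|_u>0$, ordered so that $\|\gamma(C_k)\|_u\ge\|\gamma(C_{k+1})\|_u$ for all $k$ (this is possible, since for each $\varepsilon>0$ only finitely many such components have $\|\gamma(C)\|_u\ge\varepsilon$). Put $L^{x,u,\mu}(\gamma)=\sum_{k\ge0}2^{-k}\|\gamma(C_k)\|_u$ (missing terms count as $0$), and $$\mathsf{len}(\gamma)=\int_0^1\int_{\mathbb{S}^{n-1}}\int_0^1 L^{x,u,\mu}(\gamma)\,dx\,d\sigma(u)\,d\mu,$$ where $\sigma$ is the rotation-invariant probability measure on $\mathbb{S}^{n-1}$. (Replacing $u$ by $-u$ does not change the integral over $x$, so equivalently one integrates over $(n-1)$-dimensional real projective space; for $n=2$, identifying $\mathbb{R}^2$ with $\mathbb{C}$, one may take $u=ie^{t\pi i}$ and integrate $dt$ over $t\in[0,1]$.) Standard parameterization: for a path $\gamma:[0,1]\to\mathbb{R}^n$, the function $t\mapsto\mathsf{len}(\gamma|_{[0,t]})$ is continuous and non-decreasing. If $\gamma$ is constant, $\widetilde\gamma=\gamma$. Otherwise, for $s\in[0,1]$, $\widetilde\gamma(s)=\gamma(t)$ where $t\in[0,1]$ is such that $\mathsf{len}(\gamma|_{[0,t]})=s\cdot\mathsf{len}(\gamma)$;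 the point $\gamma(t)$ does not depend on the choice of such $t$. Then $\widetilde\gamma$ is a path, $\widetilde\gamma\approx\gamma$, and $\gamma_1\approx\gamma_2$ implies $\widetilde{\gamma_1}=\widetilde{\gamma_2}$. *)

theory Defs
  imports "HOL-Probability.Probability"
begin

text \<open>
  A path is a function on all of \<open>real\<close> with \<^const>\<open>path\<close>, i.e. continuous on \<open>{0..1}\<close>; values
  outside \<open>{0..1}\<close> carry no information.  The condition \<open>\<gamma> t = \<gamma>' t'\<close> whenever
  \<open>m t = m' t'\<close> is the equation \<open>\<gamma> \<circ> m\<inverse> = \<gamma>' \<circ> m'\<inverse>\<close>.
\<close>

definition nondecreasing_onto :: "(real \<Rightarrow> real) \<Rightarrow> bool" where
  "nondecreasing_onto m \<longleftrightarrow> mono_on {0..1} m \<and> m ` {0..1} = {0..1}"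

definition constant_on_fibers :: "(real \<Rightarrow> 'a) \<Rightarrow> (real \<Rightarrow> real) \<Rightarrow> bool" where
  "constant_on_fibers \<gamma> m \<longleftrightarrow> (\<forall>s\<in>{0..1}. \<gamma> constant_on {t\<in>{0..1}. m t = s})"

definition reparam_equiv :: "(real \<Rightarrow> 'a) \<Rightarrow> (real \<Rightarrow> 'a) \<Rightarrow> bool" where
  "reparam_equiv \<gamma> \<gamma>' \<longleftrightarrow>
     (\<exists>m m'. nondecreasing_onto m \<and> nondecreasing_onto m' \<and>
        constant_on_fibers \<gamma> m \<and> constant_on_fibers \<gamma>' m' \<and>
        (\<forall>t\<in>{0..1}. \<forall>t'\<in>{0..1}. m t = m' t' \<longrightarrow> \<gamma> t = \<gamma>' t'))"

definition path_classes :: "(real \<Rightarrow> 'a::topological_space) set set" where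
  "path_classes =
     Collect path // {(\<gamma>, \<gamma>'). path \<gamma> \<and> path \<gamma>' \<and> reparam_equiv \<gamma> \<gamma>'}"

text \<open>
  Radial projection of the normalised Lebesgue measure of the unit ball.  It is a measure on the
  ambient space concentrated on the sphere; \<open>sphere_measure_sphere\<close> and
  \<open>sphere_measure_invariant\<close> below confirm the two properties that characterise it.
\<close>

definition sphere_measure :: "'a::euclidean_space measure" where
  "sphere_measure = distr (uniform_measure lborel (ball 0 1)) borel sgn"

lemma sgn_borel_measurable [measurable]:
  "(sgn :: 'a::euclidean_space \<Rightarrow> 'a) \<in> borel_measurable borel"
  unfolding sgn_div_norm[abs_def] by measurable

lemma sets_sphere_measure [simp, measurable_cong]: "sets sphere_measure = sets borel"
  by (simp add: sphere_measure_def)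

lemma space_sphere_measure [simp]: "space sphere_measure = UNIV"
  by (simp add: sphere_measure_def)

lemma prob_space_sphere_measure: "prob_space (sphere_measure :: 'a::euclidean_space measure)"
proof -
  have "emeasure lborel (ball (0::'a) 1) \<noteq> 0"
    using unit_ball_vol_pos[of "real DIM('a)"] by (auto simp: emeasure_ball simp del: unit_ball_vol_pos)
  moreover have "emeasure lborel (ball (0::'a) 1) \<noteq> \<infinity>"
    using emeasure_lborel_ball_finite[of "0::'a" 1] by simp
  ultimately have "prob_space (uniform_measure lborel (ball (0::'a) 1))"
    by (intro prob_space_uniform_measure)
  then show ?thesis
    unfolding sphere_measure_def by (rule prob_space.prob_space_distr) simp
qed

lemma sphere_measure_sphere: "emeasure sphere_measure (sphere (0::'a::euclidean_space) 1) = 1"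
proof -
  interpret prob_space "sphere_measure :: 'a measure"
    by (rule prob_space_sphere_measure)
  have vim: "sgn -` (- sphere (0::'a) 1) = {0}"
    by (auto simp: norm_sgn split: if_splits)
  have "emeasure sphere_measure (- sphere (0::'a) 1) = 0"
    unfolding sphere_measure_def
    by (subst emeasure_distr) (auto simp: vim emeasure_uniform_measure Int_insert_right)
  then have "AE u in sphere_measure. u \<in> sphere (0::'a) 1"
    by (intro AE_I[where N = "- sphere (0::'a) 1"]) auto
  then show ?thesis
    by (intro emeasure_eq_1_AE) auto
qed

lemma vimage_orthogonal_transformation_ball:
  fixes f :: "'a::euclidean_space \<Rightarrow> 'a"
  assumes f: "orthogonal_transformation f"
  shows "f -` ball c r = ball (inv f c) r"
proof -
  have "dist c (f x) = dist (inv f c) x" for x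
  proof -
    have "dist (f (inv f c)) (f x) = dist (inv f c) x"
      using f by (simp add: orthogonal_transformation_isometry)
    then show ?thesis
      using orthogonal_transformation_surj[OF f] by (simp add: surj_f_inv_f)
  qed
  then show ?thesis
    by auto
qed

lemma emeasure_open_le_vimage_orthogonal:
  fixes f :: "'a::euclidean_space \<Rightarrow> 'a"
  assumes f: "orthogonal_transformation f" and U: "open U"
  shows "emeasure lborel U \<le> emeasure lborel (f -` U)"
proof -
  have cont: "continuous_on UNIV f"
    by (intro linear_continuous_on iffD1[OF linear_conv_bounded_linear]
        orthogonal_transformation_linear f)
  define K where "K = {p :: 'a \<times> real. ball (fst p) (snd p) \<subseteq> U}"
  have "\<exists>p. p \<in> K \<and> x \<in> ball (fst p) (snd p) \<and> snd p < d" if "x \<in> U" "0 < d" for x d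
  proof -
    obtain e where "e > 0" "ball x e \<subseteq> U"
      using openE[OF U \<open>x \<in> U\<close>] by metis
    then have "ball x (min e (d/2)) \<subseteq> U"
      by auto
    then show ?thesis
      using \<open>e > 0\<close> \<open>0 < d\<close> by (intro exI[of _ "(x, min e (d/2))"]) (auto simp: K_def)
  qed
  then obtain C where C: "countable C" "C \<subseteq> K"
    and pw: "pairwise (\<lambda>i j. disjnt (ball (fst i) (snd i)) (ball (fst j) (snd j))) C"
    and neg: "negligible (U - (\<Union>i\<in>C. ball (fst i) (snd i)))"
    by (rule Vitali_covering_theorem_balls[of U K fst snd]) auto
  define W where "W = (\<Union>i\<in>C. ball (fst i) (snd i))"
  have W: "W \<subseteq> U" "open W"
    using C by (auto simp: W_def K_def)
  have "U - W \<in> null_sets lborel"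
    using neg W U
    by (auto simp: W_def[symmetric] negligible_iff_null_sets null_sets_def)
  then have "emeasure lborel U = emeasure lborel W"
    using W U emeasure_Un_null_set[of W lborel "U - W"] by (simp add: Un_absorb1)
  also have "\<dots> = (\<integral>\<^sup>+i. emeasure lborel (ball (fst i) (snd i)) \<partial>count_space C)"
    unfolding W_def using C pw
    by (intro emeasure_UN_countable)
      (auto simp: disjoint_family_on_def pairwise_def disjnt_def)
  also have "\<dots> = (\<integral>\<^sup>+i. emeasure lborel (f -` ball (fst i) (snd i)) \<partial>count_space C)"
  proof (intro nn_integral_cong)
    fix i :: "'a \<times> real"
    have "emeasure lborel (ball (fst i) (snd i)) = emeasure lborel (ball (inv f (fst i)) (snd i))"
      by (cases "snd i \<ge> 0") (simp_all add: emeasure_ball ball_empty)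
    then show "emeasure lborel (ball (fst i) (snd i)) = emeasure lborel (f -` ball (fst i) (snd i))"
      using vimage_orthogonal_transformation_ball[OF f] by metis
  qed
  also have "\<dots> = emeasure lborel (\<Union>i\<in>C. f -` ball (fst i) (snd i))"
  proof (rule emeasure_UN_countable[symmetric])
    show "disjoint_family_on (\<lambda>i. f -` ball (fst i) (snd i)) C"
      using pw unfolding disjoint_family_on_def pairwise_def disjnt_def by blast
  qed (use C in \<open>auto simp: vimage_orthogonal_transformation_ball[OF f]\<close>)
  also have "\<dots> \<le> emeasure lborel (f -` U)"
    using W U by (intro emeasure_mono) (auto simp: W_def intro!: borel_open open_vimage[OF _ cont])
  finally show ?thesis .
qed

lemma lborel_distr_orthogonal:
  fixes f :: "'a::euclidean_space \<Rightarrow> 'a"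
  assumes f: "orthogonal_transformation f"
  shows "distr lborel borel f = lborel"
proof -
  have cont: "continuous_on UNIV f"
    by (intro linear_continuous_on iffD1[OF linear_conv_bounded_linear]
        orthogonal_transformation_linear f)
  then have [measurable]: "f \<in> borel_measurable borel"
    by (rule borel_measurable_continuous_onI)
  have eq: "emeasure lborel U = emeasure lborel (f -` U)" if U: "open U" for U
  proof (rule antisym)
    show "emeasure lborel U \<le> emeasure lborel (f -` U)"
      by (rule emeasure_open_le_vimage_orthogonal[OF f U])
    have "emeasure lborel (f -` U) \<le> emeasure lborel (inv f -` (f -` U))"
      by (intro emeasure_open_le_vimage_orthogonal orthogonal_transformation_inv f
          open_vimage[OF U cont])
    also have "inv f -` (f -` U) = U"
      using orthogonal_transformation_surj[OF f] by (auto simp: surj_f_inv_f)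
    finally show "emeasure lborel (f -` U) \<le> emeasure lborel U" .
  qed
  show ?thesis
  proof (rule measure_eqI_generator_eq[where \<Omega> = UNIV and E = "Collect open"
        and A = "\<lambda>i. ball 0 (real i)"])
    show "emeasure (distr lborel borel f) X = emeasure lborel X" if "X \<in> Collect open" for X
      using that by (subst emeasure_distr) (auto simp: eq)
    show "(\<Union>i. ball 0 (real i)) = (UNIV :: 'a set)"
      by (auto simp: reals_Archimedean2)
    show "emeasure (distr lborel borel f) (ball 0 (real i)) \<noteq> \<infinity>" for i
      using eq[of "ball 0 (real i)"] emeasure_lborel_ball_finite[of "0::'a" "real i"]
      by (subst emeasure_distr) auto
  qed (auto simp: Int_stable_def borel_def)
qed

lemma sphere_measure_invariant:
  fixes f :: "'a::euclidean_space \<Rightarrow> 'a"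
  assumes f: "orthogonal_transformation f"
  shows "distr sphere_measure borel f = sphere_measure"
proof (rule measure_eqI)
  fix A assume "A \<in> sets (distr sphere_measure borel f)"
  then have A [measurable]: "A \<in> sets borel"
    by simp
  have "continuous_on UNIV f"
    by (intro linear_continuous_on iffD1[OF linear_conv_bounded_linear]
        orthogonal_transformation_linear f)
  then have f_meas [measurable]: "f \<in> borel_measurable borel"
    by (rule borel_measurable_continuous_onI)
  have [measurable]: "f -` A \<in> sets borel" "sgn -` A \<in> sets borel"
    using measurable_sets[OF f_meas A] measurable_sets[OF sgn_borel_measurable A] by simp_all
  have [measurable]: "sgn -` (f -` A) \<in> sets borel"
    using measurable_sets[OF sgn_borel_measurable \<open>f -` A \<in> sets borel\<close>] by simp
  have sgn: "f (sgn z) = sgn (f z)" for z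
    using f by (simp add: sgn_div_norm linear_cmul orthogonal_transformation_linear
        orthogonal_transformation_norm)
  have vim: "f -` (ball 0 1 \<inter> sgn -` A) = ball 0 1 \<inter> sgn -` (f -` A)"
    using f by (auto simp: sgn orthogonal_transformation_norm)
  have "emeasure (distr sphere_measure borel f) A
      = emeasure lborel (ball 0 1 \<inter> sgn -` (f -` A)) / emeasure lborel (ball (0::'a) 1)"
    unfolding sphere_measure_def
    by (simp add: emeasure_distr emeasure_uniform_measure)
  also have "emeasure lborel (ball 0 1 \<inter> sgn -` (f -` A))
      = emeasure (distr lborel borel f) (ball 0 1 \<inter> sgn -` A)"
    by (subst emeasure_distr) (auto simp only: vim, simp_all)
  also have "\<dots> = emeasure lborel (ball 0 1 \<inter> sgn -` A)"
    by (simp add: lborel_distr_orthogonal[OF f])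
  also have "\<dots> / emeasure lborel (ball (0::'a) 1) = emeasure sphere_measure A"
    unfolding sphere_measure_def
    by (simp add: emeasure_distr emeasure_uniform_measure)
  finally show "emeasure (distr sphere_measure borel f) A = emeasure sphere_measure A" .
qed simp

definition slab :: "'a::euclidean_space \<Rightarrow> real \<Rightarrow> real \<Rightarrow> int \<Rightarrow> 'a set" where
  "slab u x \<mu> j = {z. \<mu> * (of_int j + x) \<le> z \<bullet> u \<and> z \<bullet> u \<le> \<mu> * (of_int j + 1 + x)}"

definition width :: "'a::euclidean_space \<Rightarrow> 'a set \<Rightarrow> real" where
  "width u A = diameter ((\<lambda>z. z \<bullet> u) ` A)"

text \<open>
  The restriction of \<open>\<gamma>\<close> to \<open>{a..b}\<close> is represented by \<open>\<gamma>\<close> together with \<open>a\<close> and \<open>b\<close>.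
  No component of positive width arises from two different slabs, since distinct slabs meet at
  most in a hyperplane orthogonal to \<open>u\<close>; hence a set of components loses no multiplicities.
\<close>

definition slab_components ::
  "(real \<Rightarrow> 'a::euclidean_space) \<Rightarrow> real \<Rightarrow> real \<Rightarrow> 'a \<Rightarrow> real \<Rightarrow> real \<Rightarrow> real set set" where
  "slab_components \<gamma> a b u x \<mu> =
     {C. (\<exists>j. C \<in> components ({a..b} \<inter> \<gamma> -` slab u x \<mu> j)) \<and> width u (\<gamma> ` C) > 0}"

definition slab_enumeration ::
  "(real \<Rightarrow> 'a::euclidean_space) \<Rightarrow> real \<Rightarrow> real \<Rightarrow> 'a \<Rightarrow> real \<Rightarrow> real
     \<Rightarrow> enat \<Rightarrow> (nat \<Rightarrow> real set) \<Rightarrow> bool" where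
  "slab_enumeration \<gamma> a b u x \<mu> N C \<longleftrightarrow>
     bij_betw C {k. enat k < N} (slab_components \<gamma> a b u x \<mu>) \<and>
     (\<forall>k. enat (Suc k) < N \<longrightarrow> width u (\<gamma> ` C (Suc k)) \<le> width u (\<gamma> ` C k))"

definition slab_sum ::
  "(real \<Rightarrow> 'a::euclidean_space) \<Rightarrow> real \<Rightarrow> real \<Rightarrow> 'a \<Rightarrow> real \<Rightarrow> real \<Rightarrow> real" where
  "slab_sum \<gamma> a b u x \<mu> =
     (SOME L. \<exists>N C. slab_enumeration \<gamma> a b u x \<mu> N C \<and>
        L = (\<Sum>k. if enat k < N then (1/2) ^ k * width u (\<gamma> ` C k) else 0))"

definition len :: "(real \<Rightarrow> 'a::euclidean_space) \<Rightarrow> real \<Rightarrow> real \<Rightarrow> real" where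
  "len \<gamma> a b =
     (LINT \<mu>:{0<..1}|lborel. LINT u:sphere 0 1|sphere_measure. LINT x:{0..1}|lborel.
        slab_sum \<gamma> a b u x \<mu>)"

definition standard_param :: "(real \<Rightarrow> 'a::euclidean_space) \<Rightarrow> real \<Rightarrow> 'a" where
  "standard_param \<gamma> =
     (if \<gamma> constant_on {0..1} then \<gamma>
      else (\<lambda>s. \<gamma> (SOME t. t \<in> {0..1} \<and> len \<gamma> 0 t = s * len \<gamma> 0 1)))"

definition equicontinuous_on :: "'a::metric_space set \<Rightarrow> ('a \<Rightarrow> 'b::metric_space) set \<Rightarrow> bool" where
  "equicontinuous_on S \<Phi> \<longleftrightarrow>
     (\<forall>x\<in>S. \<forall>\<epsilon>>0. \<exists>\<delta>>0. \<forall>f\<in>\<Phi>. \<forall>y\<in>S. dist y x < \<delta> \<longrightarrow> dist (f y) (f x) < \<epsilon>)"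

lemma equicontinuous_on_compact_iff_uniform:
  assumes "compact S"
  shows "equicontinuous_on S \<Phi> \<longleftrightarrow>
     (\<forall>\<epsilon>>0. \<exists>\<delta>>0. \<forall>f\<in>\<Phi>. \<forall>x\<in>S. \<forall>y\<in>S. dist y x < \<delta> \<longrightarrow> dist (f y) (f x) < \<epsilon>)"
proof
  assume "equicontinuous_on S \<Phi>"
  then show "\<forall>\<epsilon>>0. \<exists>\<delta>>0. \<forall>f\<in>\<Phi>. \<forall>x\<in>S. \<forall>y\<in>S. dist y x < \<delta> \<longrightarrow> dist (f y) (f x) < \<epsilon>"
    using compact_uniformly_equicontinuous[OF assms, of \<Phi>]
    unfolding equicontinuous_on_def by (smt (verit, ccfv_threshold))
next
  assume "\<forall>\<epsilon>>0. \<exists>\<delta>>0. \<forall>f\<in>\<Phi>. \<forall>x\<in>S. \<forall>y\<in>S. dist y x < \<delta> \<longrightarrow> dist (f y) (f x) < \<epsilon>"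
  then show "equicontinuous_on S \<Phi>"
    unfolding equicontinuous_on_def by meson
qed

text \<open>
  Subintervals may be open, closed, half-open or degenerate.  For \<open>\<epsilon> > 0\<close> the diameter
  condition excludes the empty set, because \<open>diameter {} = 0\<close>.
\<close>

definition uniformly_bounded_oscillation ::
  "(real \<Rightarrow> 'a::metric_space) set set \<Rightarrow> bool" where
  "uniformly_bounded_oscillation \<F> \<longleftrightarrow>
     (\<forall>\<epsilon>>0. \<exists>N::nat. N > 0 \<and>
        (\<forall>\<gamma>\<in>\<Union>\<F>. \<not> (\<exists>\<I>. (\<forall>I\<in>\<I>. is_interval I \<and> I \<subseteq> {0..1} \<and> diameter (\<gamma> ` I) \<ge> \<epsilon>) \<and>
           disjoint \<I> \<and> (infinite \<I> \<or> card \<I> > N))))"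

end

theory Submission
  imports Defs
begin

text \<open>
  For fixed \<open>u\<close>, \<open>x\<close> and \<open>\<mu>\<close> the weighted sum over slab components is
  the supremum of \<open>\<Sum>k\<in>K. 2\<^sup>-\<^sup>k * w k\<close> over finite families of
  subintervals of widths \<open>w k\<close> that lie in pairwise different components, indexed by arbitrary
  finite sets \<open>K\<close> of naturals.  This form is monotone in the right end point,
  it changes by at most four times the oscillation when the path is prolonged, and restricting the
  end points to rationals shows joint measurability.

  Suppose \<open>\<gamma>\<close> moves by at least \<open>\<epsilon>\<close> between \<open>b\<close> and \<open>c\<close>.  For \<open>\<mu>\<close> between \<open>\<epsilon> / 16\<close> and
  \<open>\<epsilon> / 8\<close> and \<open>u\<close> in a cap of measure at least \<open>4\<^sup>-\<^sup>n\<close> the path crosses a whole slab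
  between \<open>b\<close> and \<open>c\<close>, and since at most \<open>2 * N\<close> components are wider than \<open>\<mu> / 2\<close>,
  this raises the sum by a definite amount.  So
  the length grows by at least some \<open>d(\<epsilon>, N) > 0\<close>.  As the total length is at most \<open>2\<close>, standard
  parameterizations are uniformly equicontinuous.  Conversely, equicontinuity bounds from below
  the lengths of disjoint intervals with large image, hence their number, and disjointness up to
  end points survives monotone reparameterization.
\<close>

section \<open>Sorted enumerations and rearrangement\<close>

text \<open>The position of an element is the number of elements that precede it in decreasing order
  of \<open>w\<close>. This number is finite, since every predecessor of \<open>b\<close> has value
  at least \<open>w b > 0\<close>, and the positions fill an initial segment of the naturals, so
  their inverse is the enumeration.\<close>

lemma sorted_enumeration_exists:
  fixes w :: "'a \<Rightarrow> real"
  assumes fin: "\<And>\<epsilon>. \<epsilon> > 0 \<Longrightarrow> finite {a \<in> A. \<epsilon> \<le> w a}"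
    and pos: "\<And>a. a \<in> A \<Longrightarrow> 0 < w a"
  obtains N C where "bij_betw C {k. enat k < N} A"
    and "\<And>k. enat (Suc k) < N \<Longrightarrow> w (C (Suc k)) \<le> w (C k)"
proof -
  have "A = (\<Union>n. {a \<in> A. inverse (real (Suc n)) \<le> w a})"
    using pos reals_Archimedean less_imp_le by fastforce
  moreover have "countable (\<Union>n. {a \<in> A. inverse (real (Suc n)) \<le> w a})"
    using fin by (intro countable_UN[OF countableI_type] countable_finite) auto
  ultimately have "countable A"
    by simp
  then have e: "inj_on (to_nat_on A) A"
    by (rule inj_on_to_nat_on)
  \<comment> \<open>Ties are broken by an injection into the naturals; it exists because positive
    values with finite superlevel sets make \<open>A\<close> countable.\<close>
  define less where "less a b \<longleftrightarrow> w a > w b \<or> w a = w b \<and> to_nat_on A a < to_nat_on A b" for a b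
  define below where "below b = {a \<in> A. less a b}" for b
  define rank where "rank b = card (below b)" for b
  have fin_below: "finite (below b)" if "b \<in> A" for b
    by (rule finite_subset[OF _ fin[OF pos[OF that]]]) (auto simp: below_def less_def)
  have rank_less: "rank a < rank b" if "less a b" "a \<in> A" "b \<in> A" for a b
    unfolding rank_def using that
    by (intro psubset_card_mono fin_below psubsetI) (auto simp: below_def less_def)
  have total: "less a b \<or> less b a" if "a \<in> A" "b \<in> A" "a \<noteq> b" for a b
  proof -
    have "to_nat_on A a \<noteq> to_nat_on A b"
      using inj_onD[OF e _ that(1,2)] that(3) by blast
    then show ?thesis
      unfolding less_def by linarith
  qed
  have inj: "inj_on rank A"
    by (intro inj_onI) (metis total rank_less less_irrefl)
  \<comment> \<open>\<open>rank\<close> has no gaps: the \<open>rank b\<close> predecessors of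
    \<open>b\<close> have distinct ranks below \<open>rank b\<close>, so they attain all of them.
    This determines the range also when \<open>A\<close> is infinite.\<close>
  have rank_below: "rank ` below b = {..<rank b}" if "b \<in> A" for b
  proof (rule card_subset_eq)
    show "card (rank ` below b) = card {..<rank b}"
      using inj by (subst card_image) (auto simp: rank_def below_def intro: inj_on_subset)
  qed (use that rank_less in \<open>auto simp: below_def\<close>)
  define N where "N = (if finite A then enat (card A) else \<infinity>)"
  have "rank ` A = {k. enat k < N}"
  proof (cases "finite A")
    case True
    have "rank b < card A" if "b \<in> A" for b
      unfolding rank_def using that True
      by (intro psubset_card_mono) (auto simp: below_def less_def)
    then have "rank ` A = {..<card A}"
      using True inj by (intro card_subset_eq) (auto simp: card_image)
    then show ?thesis
      using True by (auto simp: N_def)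
  next
    case False
    then have "infinite (rank ` A)"
      using inj finite_imageD by blast
    then have "n \<in> rank ` A" for n
    proof -
      obtain b where "b \<in> A" "n < rank b"
        using \<open>infinite (rank ` A)\<close> by (auto simp: infinite_nat_iff_unbounded)
      then have "n \<in> rank ` below b"
        using rank_below by auto
      then show ?thesis
        by (auto simp: below_def)
    qed
    then show ?thesis
      using False by (auto simp: N_def)
  qed
  then have rank: "bij_betw rank A {k. enat k < N}"
    using inj by (simp add: bij_betw_def)
  define C where "C = inv_into A rank"
  have C: "bij_betw C {k. enat k < N} A"
    unfolding C_def using rank by (rule bij_betw_inv_into)
  moreover have "w (C (Suc k)) \<le> w (C k)" if k: "enat (Suc k) < N" for k
  proof (rule ccontr)
    assume "\<not> ?thesis"
    then have "less (C (Suc k)) (C k)"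
      by (simp add: less_def)
    moreover have "enat k < N"
      using k by (metis Suc_ile_eq less_imp_le)
    ultimately have "rank (C (Suc k)) < rank (C k)"
      using k C by (intro rank_less) (auto dest: bij_betwE)
    then show False
      using k \<open>enat k < N\<close> rank by (simp add: C_def bij_betw_inv_into_right)
  qed
  ultimately show ?thesis
    by (rule that)
qed

text \<open>Larger values should carry larger weights. The induction is on the number
  \<open>Suc m\<close> of terms: moving the least value to the greatest index of \<open>K\<close>
  does not decrease the sum, and the term at that index is at most term \<open>m\<close> of the
  sorted sum.\<close>

lemma rearrangement_le:
  fixes w :: "'a \<Rightarrow> real"
  assumes C: "bij_betw C {k. enat k < N} A"
    and dec: "\<And>k. enat (Suc k) < N \<Longrightarrow> w (C (Suc k)) \<le> w (C k)"
    and nonneg: "\<And>a. a \<in> A \<Longrightarrow> 0 \<le> w a"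
    and "finite K" "inj_on \<phi> K" "\<phi> ` K \<subseteq> A"
  shows "(\<Sum>k\<in>K. (1/2) ^ k * w (\<phi> k))
    \<le> (\<Sum>i<card K. if enat i < N then (1/2) ^ i * w (C i) else 0)"
  using assms(4-6)
proof (induction "card K" arbitrary: K \<phi>)
  case 0
  then show ?case by simp
next
  case (Suc m K \<phi>)
  have anti: "w (C i) \<le> w (C m)" if "m \<le> i" "enat i < N" for i
    using that
  proof (induction i rule: dec_induct)
    case (step n)
    have "enat n < N"
      using step.prems by (metis Suc_ile_eq less_imp_le)
    then show ?case
      using step dec[of n] by simp
  qed simp
  have ne: "K \<noteq> {}" and fin: "finite K"
    using Suc by auto
  define k\<^sub>1 where "k\<^sub>1 = Max K"
  have k1: "k\<^sub>1 \<in> K"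
    using ne fin by (simp add: k\<^sub>1_def)
  have "K \<subseteq> {..k\<^sub>1}"
    using fin by (auto simp: k\<^sub>1_def)
  then have "m \<le> k\<^sub>1"
    using card_mono[of "{..k\<^sub>1}" K] Suc(2) by simp
  obtain k\<^sub>0 where k0: "k\<^sub>0 \<in> K" and min: "\<And>k. k \<in> K \<Longrightarrow> w (\<phi> k\<^sub>0) \<le> w (\<phi> k)"
    using ex_is_arg_min_if_finite[OF fin ne, of "\<lambda>k. w (\<phi> k)"]
    by (auto simp: is_arg_min_linorder)
  \<comment> \<open>The \<open>Suc m\<close> distinct elements occupy distinct sorted positions, so
    one of these positions is at least \<open>m\<close>; the least value is bounded through the
    element found there.\<close>
  have min_le: "enat m < N \<and> w (\<phi> k\<^sub>0) \<le> w (C m)"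
  proof -
    define D where "D = inv_into {k. enat k < N} C"
    have D: "bij_betw D A {k. enat k < N}"
      unfolding D_def using C by (rule bij_betw_inv_into)
    have "card (D ` \<phi> ` K) = Suc m"
      using Suc D by (metis card_image bij_betw_imp_inj_on inj_on_subset)
    then have "\<not> D ` \<phi> ` K \<subseteq> {..<m}"
      using card_mono[of "{..<m}" "D ` \<phi> ` K"] by auto
    then obtain k where k: "k \<in> K" "m \<le> D (\<phi> k)"
      using leI by blast
    have "\<phi> k \<in> A"
      using k Suc by auto
    then have "enat (D (\<phi> k)) < N" "C (D (\<phi> k)) = \<phi> k"
      using bij_betwE[OF D] C by (auto simp: D_def bij_betw_inv_into_right)
    then show ?thesis
      using anti[of "D (\<phi> k)"] k min[of k] by (metis enat_ord_simps(1) le_less_trans order_trans)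
  qed
  define \<psi> where "\<psi> = \<phi>(k\<^sub>0 := \<phi> k\<^sub>1, k\<^sub>1 := \<phi> k\<^sub>0)"
  have swap: "(\<Sum>k\<in>K. (1/2) ^ k * w (\<phi> k)) \<le> (\<Sum>k\<in>K. (1/2) ^ k * w (\<psi> k))"
  proof (cases "k\<^sub>0 = k\<^sub>1")
    case True
    then show ?thesis by (simp add: \<psi>_def)
  next
    case False
    have split: "sum g K = g k\<^sub>0 + g k\<^sub>1 + sum g (K - {k\<^sub>0, k\<^sub>1})" for g :: "nat \<Rightarrow> real"
    proof -
      have "sum g K = sum g {k\<^sub>0, k\<^sub>1} + sum g (K - {k\<^sub>0, k\<^sub>1})"
        using fin k0 k1 by (subst sum.subset_diff[of "{k\<^sub>0,k\<^sub>1}"]) (auto simp: add.commute)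
      then show ?thesis
        using False by simp
    qed
    have rest: "(\<Sum>k\<in>K - {k\<^sub>0, k\<^sub>1}. (1/2) ^ k * w (\<psi> k)) = (\<Sum>k\<in>K - {k\<^sub>0, k\<^sub>1}. (1/2) ^ k * w (\<phi> k))"
      by (intro sum.cong) (auto simp: \<psi>_def)
    have "(1/2::real) ^ k\<^sub>1 \<le> (1/2) ^ k\<^sub>0"
      using k0 fin by (intro power_decreasing) (auto simp: k\<^sub>1_def)
    \<comment> \<open>This product, difference of weights times difference of values, is exactly the
      gain of the swap.\<close>
    then have "0 \<le> ((1/2) ^ k\<^sub>0 - (1/2) ^ k\<^sub>1) * (w (\<phi> k\<^sub>1) - w (\<phi> k\<^sub>0))"
      using min[OF k1] by (intro mult_nonneg_nonneg) auto
    moreover have "\<psi> k\<^sub>0 = \<phi> k\<^sub>1" "\<psi> k\<^sub>1 = \<phi> k\<^sub>0"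
      using False by (auto simp: \<psi>_def)
    ultimately show ?thesis
      using rest by (simp add: split algebra_simps)
  qed
  have IH: "(\<Sum>k\<in>K - {k\<^sub>1}. (1/2) ^ k * w (\<psi> k))
      \<le> (\<Sum>i<card (K - {k\<^sub>1}). if enat i < N then (1/2) ^ i * w (C i) else 0)"
  proof (rule Suc.hyps(1))
    show "inj_on \<psi> (K - {k\<^sub>1})"
      using Suc.prems(2) k0 k1 by (auto simp: \<psi>_def inj_on_def)
    show "\<psi> ` (K - {k\<^sub>1}) \<subseteq> A"
      using Suc.prems(3) k0 k1 by (auto simp: \<psi>_def)
  qed (use Suc k1 in auto)
  have card: "card (K - {k\<^sub>1}) = m"
    using Suc k1 by simp
  have "(\<Sum>k\<in>K. (1/2) ^ k * w (\<psi> k)) = (1/2) ^ k\<^sub>1 * w (\<phi> k\<^sub>0) + (\<Sum>k\<in>K - {k\<^sub>1}. (1/2) ^ k * w (\<psi> k))"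
    using fin k1 by (subst sum.remove[of K k\<^sub>1]) (auto simp: \<psi>_def)
  moreover have "(1/2) ^ k\<^sub>1 * w (\<phi> k\<^sub>0) \<le> (1/2) ^ m * w (C m)"
    using min_le \<open>m \<le> k\<^sub>1\<close> nonneg[of "\<phi> k\<^sub>0"] k0 Suc.prems
    by (intro mult_mono power_decreasing) auto
  ultimately show ?case
    using swap IH min_le by (simp add: card flip: Suc.hyps(2))
qed

text \<open>Compares Lebesgue measures. The intervals are open because the images of disjoint
  intervals under a monotone map may share end points.\<close>

lemma card_disjoint_open_intervals_le:
  fixes p q :: "'i \<Rightarrow> real" and a b \<delta> :: real
  assumes "finite S" "a \<le> b"
    and bnd: "\<And>i. i \<in> S \<Longrightarrow> a \<le> p i \<and> q i \<le> b \<and> \<delta> \<le> q i - p i" and "0 < \<delta>"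
    and disj: "\<And>i j. i \<in> S \<Longrightarrow> j \<in> S \<Longrightarrow> i \<noteq> j \<Longrightarrow> {p i<..<q i} \<inter> {p j<..<q j} = {}"
  shows "card S * \<delta> \<le> b - a"
proof -
  have less: "p i < q i" if "i \<in> S" for i
    using bnd[OF that] \<open>0 < \<delta>\<close> by linarith
  have "card S * \<delta> \<le> (\<Sum>i\<in>S. q i - p i)"
    using bnd by (intro sum_bounded_below) auto
  also have "\<dots> = (\<Sum>i\<in>S. measure lborel {p i<..<q i})"
    using less by (intro sum.cong) (auto simp: less_imp_le)
  also have "\<dots> = measure lborel (\<Union>i\<in>S. {p i<..<q i})"
    using \<open>finite S\<close> disj less
    by (intro measure_finite_Union[symmetric])
      (auto simp: disjoint_family_on_def less_imp_le)
  also have "\<dots> \<le> measure lborel {a..b}"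
  proof (rule measure_mono_fmeasurable)
    show "(\<Union>i\<in>S. {p i<..<q i}) \<subseteq> {a..b}"
      using bnd by force
  qed (use \<open>finite S\<close> in \<open>auto simp: fmeasurable_def emeasure_lborel_Icc_eq\<close>)
  finally show ?thesis
    using \<open>a \<le> b\<close> by simp
qed

section \<open>Oscillation and reparameterization\<close>

text \<open>The oscillation property for one path and fixed parameters, in positive form. Finiteness
  is a separate conjunct because \<open>card\<close> is 0 on infinite sets.\<close>

definition few_oscillations :: "(real \<Rightarrow> 'a::metric_space) \<Rightarrow> real \<Rightarrow> nat \<Rightarrow> bool" where
  "few_oscillations \<gamma> \<epsilon> N \<longleftrightarrow>
     (\<forall>\<I>. (\<forall>I\<in>\<I>. is_interval I \<and> I \<subseteq> {0..1} \<and> \<epsilon> \<le> diameter (\<gamma> ` I)) \<longrightarrow> disjoint \<I> \<longrightarrow>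
        finite \<I> \<and> card \<I> \<le> N)"

lemma uniformly_bounded_oscillation_iff:
  "uniformly_bounded_oscillation \<F> \<longleftrightarrow>
     (\<forall>\<epsilon>>0. \<exists>N>0. \<forall>\<gamma>\<in>\<Union>\<F>. few_oscillations \<gamma> \<epsilon> N)"
proof -
  have "few_oscillations \<gamma> \<epsilon> N \<longleftrightarrow>
      \<not> (\<exists>\<I>. (\<forall>I\<in>\<I>. is_interval I \<and> I \<subseteq> {0..1} \<and> diameter (\<gamma> ` I) \<ge> \<epsilon>) \<and>
        disjoint \<I> \<and> (infinite \<I> \<or> card \<I> > N))" for \<gamma> :: "real \<Rightarrow> 'a" and \<epsilon> N
    unfolding few_oscillations_def not_le[symmetric] by blast
  then show ?thesis
    unfolding uniformly_bounded_oscillation_def by simp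
qed

lemma bounded_path_image_subset:
  fixes \<gamma> :: "real \<Rightarrow> 'a::metric_space"
  assumes "continuous_on {a..b} \<gamma>" "I \<subseteq> {a..b}"
  shows "bounded (\<gamma> ` I)"
  using compact_imp_bounded[OF compact_continuous_image[OF assms(1) compact_Icc]] assms(2)
  by (meson bounded_subset image_mono)

text \<open>Every interval of the family contains two points whose images are more than
  \<open>\<epsilon> / 2\<close> apart; half of the bound, because the diameter need not be attained.
  Their \<open>\<tau>\<close> values span open intervals of length at least \<open>\<delta>\<close>
  in the unit interval, pairwise disjoint by monotonicity, and at most \<open>1 / \<delta>\<close>
  of these fit.\<close>

lemma few_oscillationsI:
  fixes \<gamma> :: "real \<Rightarrow> 'a::metric_space"
  assumes \<gamma>: "path \<gamma>" and \<tau>: "mono_on {0..1} \<tau>" "\<tau> ` {0..1} \<subseteq> {0..1}"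
    and sep: "\<And>p q. p \<in> {0..1} \<Longrightarrow> q \<in> {0..1} \<Longrightarrow> \<epsilon> / 2 < dist (\<gamma> p) (\<gamma> q) \<Longrightarrow> \<delta> \<le> \<bar>\<tau> p - \<tau> q\<bar>"
    and "0 < \<epsilon>" "0 < \<delta>" and N: "1 / \<delta> \<le> real N"
  shows "few_oscillations \<gamma> \<epsilon> N"
proof -
  have card: "card \<I> \<le> N"
    if \<I>: "\<And>I. I \<in> \<I> \<Longrightarrow> is_interval I \<and> I \<subseteq> {0..1} \<and> \<epsilon> \<le> diameter (\<gamma> ` I)"
      and disj: "disjoint \<I>" and fin: "finite \<I>" for \<I>
  proof -
    have "\<exists>p q. p \<in> I \<and> q \<in> I \<and> p \<le> q \<and> \<epsilon> / 2 < dist (\<gamma> p) (\<gamma> q)" if I: "I \<in> \<I>" for I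
    proof -
      have "bounded (\<gamma> ` I)"
        using \<gamma> \<I>[OF I] bounded_path_image_subset[of 0 1 \<gamma> I] by (simp add: path_def)
      then obtain p q where "p \<in> I" "q \<in> I" "\<epsilon> / 2 < dist (\<gamma> p) (\<gamma> q)"
        using diameter_lower_bounded[of "\<gamma> ` I" "\<epsilon> / 2"] \<open>0 < \<epsilon>\<close> \<I>[OF I] by auto
      then show ?thesis
        by (metis dist_commute linear)
    qed
    then obtain p q where pq: "\<And>I. I \<in> \<I> \<Longrightarrow> p I \<in> I \<and> q I \<in> I \<and> p I \<le> q I \<and> \<epsilon> / 2 < dist (\<gamma> (p I)) (\<gamma> (q I))"
      by metis
    have pq01: "p I \<in> {0..1}" "q I \<in> {0..1}" if "I \<in> \<I>" for I
      using pq[OF that] \<I>[OF that] by auto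
    have mono: "\<tau> s \<le> \<tau> t" if "s \<in> {0..1}" "t \<in> {0..1}" "s \<le> t" for s t
      using \<tau>(1) that by (auto simp: mono_on_def)
    have "card \<I> * \<delta> \<le> 1 - 0"
    proof (rule card_disjoint_open_intervals_le[where p = "\<lambda>I. \<tau> (p I)" and q = "\<lambda>I. \<tau> (q I)"])
      fix I assume I: "I \<in> \<I>"
      have "\<tau> (p I) \<le> \<tau> (q I)" "\<delta> \<le> \<bar>\<tau> (p I) - \<tau> (q I)\<bar>"
        using pq[OF I] pq01[OF I] by (auto intro: mono sep)
      moreover have "\<tau> (p I) \<in> {0..1}" "\<tau> (q I) \<in> {0..1}"
        using \<tau>(2) pq01[OF I] by blast+
      ultimately show "0 \<le> \<tau> (p I) \<and> \<tau> (q I) \<le> 1 \<and> \<delta> \<le> \<tau> (q I) - \<tau> (p I)"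
        by auto
    next
      fix I J assume IJ: "I \<in> \<I>" "J \<in> \<I>" "I \<noteq> J"
      then have "I \<inter> J = {}"
        using disj by (auto simp: pairwise_def disjnt_def)
      \<comment> \<open>If neither pair of points precedes the other, the larger of the two left
        points lies in both intervals.\<close>
      have "q I < p J \<or> q J < p I"
      proof (rule ccontr)
        assume "\<not> ?thesis"
        then have "max (p I) (p J) \<in> I" "max (p I) (p J) \<in> J"
          using pq[OF IJ(1)] pq[OF IJ(2)] \<I>[OF IJ(1)] \<I>[OF IJ(2)]
          by (auto simp: max_def intro: mem_is_interval_1_I)
        then show False
          using \<open>I \<inter> J = {}\<close> by auto
      qed
      then have "\<tau> (q I) \<le> \<tau> (p J) \<or> \<tau> (q J) \<le> \<tau> (p I)"
        using pq01 IJ by (auto intro: mono)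
      then show "{\<tau> (p I)<..<\<tau> (q I)} \<inter> {\<tau> (p J)<..<\<tau> (q J)} = {}"
        by auto
    qed (use fin \<open>0 < \<delta>\<close> in auto)
    then have "real (card \<I>) \<le> 1 / \<delta>"
      using \<open>0 < \<delta>\<close> by (simp add: field_simps)
    then show ?thesis
      using N by linarith
  qed
  \<comment> \<open>An infinite family would contain a finite one with \<open>N + 1\<close>
    members.\<close>
  have "finite \<I>"
    if \<I>: "\<And>I. I \<in> \<I> \<Longrightarrow> is_interval I \<and> I \<subseteq> {0..1} \<and> \<epsilon> \<le> diameter (\<gamma> ` I)"
      and disj: "disjoint \<I>" for \<I>
  proof (rule ccontr)
    assume "infinite \<I>"
    then obtain \<J> where "\<J> \<subseteq> \<I>" "finite \<J>" "card \<J> = Suc N"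
      using infinite_arbitrarily_large by blast
    moreover have "disjoint \<J>"
      using disj \<open>\<J> \<subseteq> \<I>\<close> by (rule pairwise_subset)
    ultimately show False
      using card[of \<J>] \<I> by (metis Suc_n_not_le_n subsetD)
  qed
  then show ?thesis
    unfolding few_oscillations_def by (intro allI impI conjI card) (simp_all only: Ball_def)
qed

text \<open>\<open>\<tau>\<close> is \<open>m\<close> followed by a right inverse of
  \<open>m'\<close>. A right inverse of a monotone map onto the interval is again monotone, although
  it may jump where \<open>m'\<close> is flat.\<close>

lemma reparam_factor:
  assumes "reparam_equiv \<gamma> \<gamma>'"
  obtains \<tau> where "mono_on {0..1} \<tau>" "\<tau> ` {0..1} \<subseteq> {0..1}" "\<And>t. t \<in> {0..1} \<Longrightarrow> \<gamma> t = \<gamma>' (\<tau> t)"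
proof -
  obtain m m' where m: "mono_on {0..1} m" "m ` {0..1} = {0..1}"
    and m': "mono_on {0..1} m'" "m' ` {0..1} = {0..1::real}"
    and eq: "\<And>t t'. t \<in> {0..1} \<Longrightarrow> t' \<in> {0..1} \<Longrightarrow> m t = m' t' \<Longrightarrow> \<gamma> t = \<gamma>' t'"
    using assms unfolding reparam_equiv_def nondecreasing_onto_def by blast
  define \<sigma> where "\<sigma> = inv_into {0..1} m'"
  have \<sigma>: "\<sigma> s \<in> {0..1}" "m' (\<sigma> s) = s" if "s \<in> {0..1}" for s
    using that m'(2) unfolding \<sigma>_def by (metis inv_into_into, metis f_inv_into_f)
  have mem: "m t \<in> {0..1}" if "t \<in> {0..1}" for t
    using m(2) that by blast
  have mono: "\<sigma> s \<le> \<sigma> s'" if "s \<le> s'" "s \<in> {0..1}" "s' \<in> {0..1}" for s s'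
  proof (rule ccontr)
    assume contra: "\<not> ?thesis"
    then have "m' (\<sigma> s') \<le> m' (\<sigma> s)"
      using m'(1) \<sigma>(1)[OF that(2)] \<sigma>(1)[OF that(3)] by (simp add: mono_on_def)
    then have "s = s'"
      using that \<sigma>(2) by auto
    then show False
      using contra by simp
  qed
  show ?thesis
  proof
    show "mono_on {0..1} (\<sigma> \<circ> m)"
      using m(1) mono mem by (simp add: mono_on_def)
    show "(\<sigma> \<circ> m) ` {0..1} \<subseteq> {0..1}"
      by (intro image_subsetI) (simp only: o_apply \<sigma>(1) mem)
    show "\<gamma> t = \<gamma>' ((\<sigma> \<circ> m) t)" if "t \<in> {0..1}" for t
      using that by (intro eq) (use \<sigma> mem in auto)
  qed
qed

section \<open>Equicontinuous choices of representatives\<close>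

lemma reparam_equiv_sym: "reparam_equiv \<gamma> \<gamma>' \<Longrightarrow> reparam_equiv \<gamma>' \<gamma>"
  unfolding reparam_equiv_def by metis

text \<open>A class consists of the paths related to one base path \<open>\<eta>\<close>. The factor
  of \<open>\<gamma>\<close> through \<open>\<eta>\<close> and the factor of \<open>\<eta>\<close>
  through \<open>\<gamma>'\<close> compose to a monotone map.\<close>

lemma path_classesD:
  assumes "X \<in> path_classes" "\<gamma> \<in> X" "\<gamma>' \<in> X"
  shows "path \<gamma>"
    and "\<exists>\<tau>. mono_on {0..1} \<tau> \<and> \<tau> ` {0..1} \<subseteq> {0..1} \<and> (\<forall>t\<in>{0..1}. \<gamma> t = \<gamma>' (\<tau> t))"
proof -
  obtain \<eta> where \<eta>: "path \<gamma>" "reparam_equiv \<eta> \<gamma>" "reparam_equiv \<eta> \<gamma>'"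
    using assms unfolding path_classes_def quotient_def by auto
  then show "path \<gamma>"
    by simp
  obtain \<tau> where \<tau>: "mono_on {0..1} \<tau>" "\<tau> ` {0..1} \<subseteq> {0..1}" "\<And>t. t \<in> {0..1} \<Longrightarrow> \<gamma> t = \<eta> (\<tau> t)"
    using reparam_factor[OF reparam_equiv_sym[OF \<eta>(2)]] by blast
  obtain \<tau>' where \<tau>': "mono_on {0..1} \<tau>'" "\<tau>' ` {0..1} \<subseteq> {0..1}" "\<And>t. t \<in> {0..1} \<Longrightarrow> \<eta> t = \<gamma>' (\<tau>' t)"
    using reparam_factor[OF \<eta>(3)] by blast
  have mem: "\<tau> t \<in> {0..1}" if "t \<in> {0..1}" for t
    using \<tau>(2) that by blast
  show "\<exists>\<tau>. mono_on {0..1} \<tau> \<and> \<tau> ` {0..1} \<subseteq> {0..1} \<and> (\<forall>t\<in>{0..1}. \<gamma> t = \<gamma>' (\<tau> t))"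
  proof (intro exI[of _ "\<tau>' \<circ> \<tau>"] conjI ballI)
    show "mono_on {0..1} (\<tau>' \<circ> \<tau>)"
      using \<tau>(1) \<tau>'(1) mem by (simp add: mono_on_def)
    show "(\<tau>' \<circ> \<tau>) ` {0..1} \<subseteq> {0..1}"
      using mem \<tau>'(2) by auto
    show "\<gamma> t = \<gamma>' ((\<tau>' \<circ> \<tau>) t)" if "t \<in> {0..1}" for t
      using that \<tau>(3) \<tau>'(3) mem by simp
  qed
qed

text \<open>On the compact parameter interval equicontinuity is uniform, so one
  \<open>\<delta>\<close> serves all chosen representatives. Every member of a class factors
  monotonically through its representative, and the count \<open>1 / \<delta>\<close> carries
  over.\<close>

lemma equicontinuous_representatives_imp_bounded_oscillation:
  fixes \<F> :: "(real \<Rightarrow> 'a::metric_space) set set"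
  assumes \<F>: "\<F> \<subseteq> path_classes" and r: "\<And>X. X \<in> \<F> \<Longrightarrow> r X \<in> X"
    and eq: "equicontinuous_on {0..1} (r ` \<F>)"
  shows "uniformly_bounded_oscillation \<F>"
  unfolding uniformly_bounded_oscillation_iff
proof (intro allI impI)
  fix \<epsilon> :: real assume "0 < \<epsilon>"
  then obtain \<delta> where \<delta>: "\<delta> > 0"
    "\<And>f x y. f \<in> r ` \<F> \<Longrightarrow> x \<in> {0..1} \<Longrightarrow> y \<in> {0..1} \<Longrightarrow> dist y x < \<delta> \<Longrightarrow> dist (f y) (f x) < \<epsilon> / 2"
    using eq equicontinuous_on_compact_iff_uniform[of "{0..1::real}" "r ` \<F>"]
    by (metis compact_Icc half_gt_zero)
  obtain N :: nat where N: "1 / \<delta> \<le> real N"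
    using real_arch_simple by blast
  \<comment> \<open>The successor only makes the bound positive, as the property demands.\<close>
  have "few_oscillations \<gamma> \<epsilon> (Suc N)" if X: "X \<in> \<F>" "\<gamma> \<in> X" for X \<gamma>
  proof -
    obtain \<tau> where \<tau>: "mono_on {0..1} \<tau>" "\<tau> ` {0..1} \<subseteq> {0..1}" "\<And>t. t \<in> {0..1} \<Longrightarrow> \<gamma> t = r X (\<tau> t)"
      using path_classesD(2)[OF _ X(2) r[OF X(1)]] \<F> X(1) by (meson subsetD)
    show ?thesis
    proof (rule few_oscillationsI[OF _ \<tau>(1,2)])
      fix p q :: real assume pq: "p \<in> {0..1}" "q \<in> {0..1}" "\<epsilon> / 2 < dist (\<gamma> p) (\<gamma> q)"
      then have mem: "\<tau> p \<in> {0..1}" "\<tau> q \<in> {0..1}"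
        using \<tau>(2) by blast+
      show "\<delta> \<le> \<bar>\<tau> p - \<tau> q\<bar>"
        using \<delta>(2)[OF imageI[OF X(1)] mem(2) mem(1)] pq \<tau>(3)
        by (force simp: dist_real_def)
    qed (use \<F> X path_classesD(1) \<open>0 < \<epsilon>\<close> \<delta> N in auto)
  qed
  then show "\<exists>N>0. \<forall>\<gamma>\<in>\<Union>\<F>. few_oscillations \<gamma> \<epsilon> N"
    by blast
qed

text \<open>Uniform continuity of a single path, with the identity as \<open>\<tau>\<close>. This
  yields the finiteness behind the sorted enumeration of components.\<close>

lemma path_few_oscillations:
  fixes \<gamma> :: "real \<Rightarrow> 'a::metric_space"
  assumes \<gamma>: "path \<gamma>" and "0 < \<epsilon>"
  obtains N where "few_oscillations \<gamma> \<epsilon> N"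
proof -
  have "uniformly_continuous_on {0..1} \<gamma>"
    using \<gamma> by (intro compact_uniformly_continuous) (auto simp: path_def)
  then obtain \<delta> where \<delta>: "\<delta> > 0"
    "\<And>x y. x \<in> {0..1} \<Longrightarrow> y \<in> {0..1} \<Longrightarrow> dist y x < \<delta> \<Longrightarrow> dist (\<gamma> y) (\<gamma> x) < \<epsilon> / 2"
    using \<open>0 < \<epsilon>\<close> unfolding uniformly_continuous_on_def by (metis half_gt_zero)
  obtain N :: nat where N: "1 / \<delta> \<le> real N"
    using real_arch_simple by blast
  have "few_oscillations \<gamma> \<epsilon> N"
  proof (rule few_oscillationsI[OF \<gamma>, where \<tau> = id])
    show "\<delta> \<le> \<bar>id p - id q\<bar>" if "p \<in> {0..1}" "q \<in> {0..1}" "\<epsilon> / 2 < dist (\<gamma> p) (\<gamma> q)" for p q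
      using \<delta>(2)[of q p] that by (force simp: dist_real_def)
  qed (use \<open>0 < \<epsilon>\<close> \<delta> N in \<open>auto simp: mono_on_def\<close>)
  then show ?thesis
    by (rule that)
qed

section \<open>Families of slab crossings\<close>

text \<open>\<open>K\<close> may have gaps, since its elements serve as exponents of the weights.
  The last clause says that two intervals in the same slab lie in different components of its
  preimage. Expressed through the hull of the intervals, it is the negation of a closed condition on
  \<open>(\<mu>, u, x)\<close>.\<close>

definition crossing_family ::
  "(real \<Rightarrow> 'a::euclidean_space) \<Rightarrow> real \<Rightarrow> real \<Rightarrow> 'a \<Rightarrow> real \<Rightarrow> real
     \<Rightarrow> nat set \<Rightarrow> (nat \<Rightarrow> int) \<Rightarrow> (nat \<Rightarrow> real) \<Rightarrow> (nat \<Rightarrow> real) \<Rightarrow> bool" where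
  "crossing_family \<gamma> a b u x \<mu> K J P Q \<longleftrightarrow> finite K \<and>
     (\<forall>k\<in>K. a \<le> P k \<and> P k \<le> Q k \<and> Q k \<le> b \<and> \<gamma> ` {P k..Q k} \<subseteq> slab u x \<mu> (J k)) \<and>
     (\<forall>k\<in>K. \<forall>l\<in>K. k \<noteq> l \<longrightarrow> J k = J l \<longrightarrow>
        \<not> \<gamma> ` {min (P k) (P l)..max (Q k) (Q l)} \<subseteq> slab u x \<mu> (J k))"

definition crossing_sum ::
  "(real \<Rightarrow> 'a::euclidean_space) \<Rightarrow> 'a \<Rightarrow> nat set \<Rightarrow> (nat \<Rightarrow> real) \<Rightarrow> (nat \<Rightarrow> real) \<Rightarrow> real" where
  "crossing_sum \<gamma> u K P Q = (\<Sum>k\<in>K. (1/2) ^ k * \<bar>(\<gamma> (Q k) - \<gamma> (P k)) \<bullet> u\<bar>)"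

definition crossing_sup ::
  "(real \<Rightarrow> 'a::euclidean_space) \<Rightarrow> real \<Rightarrow> real \<Rightarrow> 'a \<Rightarrow> real \<Rightarrow> real \<Rightarrow> real" where
  "crossing_sup \<gamma> a b u x \<mu> =
     Sup {crossing_sum \<gamma> u K P Q |K J P Q. crossing_family \<gamma> a b u x \<mu> K J P Q}"

lemma crossing_familyD:
  assumes "crossing_family \<gamma> a b u x \<mu> K J P Q" "k \<in> K"
  shows "a \<le> P k" "P k \<le> Q k" "Q k \<le> b" "\<gamma> ` {P k..Q k} \<subseteq> slab u x \<mu> (J k)"
  using assms by (auto simp: crossing_family_def)

lemma crossing_family_finite: "crossing_family \<gamma> a b u x \<mu> K J P Q \<Longrightarrow> finite K"
  by (simp add: crossing_family_def)

lemma crossing_family_unlinked: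
  assumes "crossing_family \<gamma> a b u x \<mu> K J P Q" "k \<in> K" "l \<in> K" "k \<noteq> l" "J k = J l"
  shows "\<not> \<gamma> ` {min (P k) (P l)..max (Q k) (Q l)} \<subseteq> slab u x \<mu> (J k)"
  using assms unfolding crossing_family_def by blast

text \<open>The hull of two old intervals is covered by these intervals and the hull of the new
  ones, so if the new hull stayed in the slab, the old one would too. This serves to truncate
  families, to pass to subfamilies and to choose rational end points.\<close>

lemma crossing_family_shrink:
  assumes F: "crossing_family \<gamma> a b u x \<mu> K J P Q" and "K' \<subseteq> K"
    and sub: "\<And>k. k \<in> K' \<Longrightarrow> P k \<le> P' k \<and> P' k \<le> Q' k \<and> Q' k \<le> Q k \<and> a' \<le> P' k \<and> Q' k \<le> b'"
  shows "crossing_family \<gamma> a' b' u x \<mu> K' J P' Q'"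
  unfolding crossing_family_def
proof (intro conjI ballI impI)
  show "finite K'"
    using F \<open>K' \<subseteq> K\<close> by (meson crossing_family_finite finite_subset)
  fix k assume k: "k \<in> K'"
  show "a' \<le> P' k" "P' k \<le> Q' k" "Q' k \<le> b'"
    using sub[OF k] by auto
  have "{P' k..Q' k} \<subseteq> {P k..Q k}"
    using sub[OF k] by auto
  then show "\<gamma> ` {P' k..Q' k} \<subseteq> slab u x \<mu> (J k)"
    using crossing_familyD(4)[OF F, of k] k \<open>K' \<subseteq> K\<close> by blast
  fix l assume l: "l \<in> K'" "k \<noteq> l" "J k = J l"
  have kl: "k \<in> K" "l \<in> K"
    using k l \<open>K' \<subseteq> K\<close> by auto
  have hull: "{min (P k) (P l)..max (Q k) (Q l)}
      \<subseteq> {P k..Q k} \<union> {P l..Q l} \<union> {min (P' k) (P' l)..max (Q' k) (Q' l)}"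
    using sub[OF k] sub[OF l(1)] by (auto simp: min_def max_def split: if_splits)
  show "\<not> \<gamma> ` {min (P' k) (P' l)..max (Q' k) (Q' l)} \<subseteq> slab u x \<mu> (J k)"
  proof
    assume "\<gamma> ` {min (P' k) (P' l)..max (Q' k) (Q' l)} \<subseteq> slab u x \<mu> (J k)"
    then have "\<gamma> ` ({P k..Q k} \<union> {P l..Q l} \<union> {min (P' k) (P' l)..max (Q' k) (Q' l)}) \<subseteq> slab u x \<mu> (J k)"
      using crossing_familyD(4)[OF F kl(1)] crossing_familyD(4)[OF F kl(2)] l(3)
      by (simp add: image_Un)
    then show False
      using crossing_family_unlinked[OF F kl l(2,3)] image_mono[OF hull, of \<gamma>] by blast
  qed
qed

lemma crossing_width_le:
  assumes "crossing_family \<gamma> a b u x \<mu> K J P Q" "k \<in> K"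
  shows "\<bar>(\<gamma> (Q k) - \<gamma> (P k)) \<bullet> u\<bar> \<le> \<bar>\<mu>\<bar>"
proof -
  have "\<gamma> (P k) \<in> slab u x \<mu> (J k)" "\<gamma> (Q k) \<in> slab u x \<mu> (J k)"
    using crossing_familyD[OF assms] by auto
  then show ?thesis
    by (auto simp: slab_def inner_diff_left algebra_simps)
qed

text \<open>The weights \<open>(1/2) ^ k\<close> add up to at most 2 over any finite index set, by
  the geometric series.\<close>

lemma weighted_sum_le:
  fixes g :: "nat \<Rightarrow> real"
  assumes "finite K" "\<And>k. k \<in> K \<Longrightarrow> g k \<le> c" "0 \<le> c"
  shows "(\<Sum>k\<in>K. (1/2) ^ k * g k) \<le> 2 * c"
proof -
  have "(\<Sum>k\<in>K. (1/2::real) ^ k) \<le> (\<Sum>k. (1/2) ^ k)"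
    using assms by (intro sum_le_suminf summable_geometric) auto
  also have "\<dots> = 2"
    by (simp add: suminf_geometric)
  finally have "(\<Sum>k\<in>K. (1/2) ^ k) * c \<le> 2 * c"
    using assms by (intro mult_right_mono) auto
  moreover have "(\<Sum>k\<in>K. (1/2) ^ k * g k) \<le> (\<Sum>k\<in>K. (1/2) ^ k * c)"
    using assms by (intro sum_mono mult_left_mono) auto
  ultimately show ?thesis
    by (simp add: sum_distrib_right)
qed

lemma crossing_sum_le:
  assumes "crossing_family \<gamma> a b u x \<mu> K J P Q"
  shows "crossing_sum \<gamma> u K P Q \<le> 2 * \<bar>\<mu>\<bar>"
  unfolding crossing_sum_def using crossing_family_finite[OF assms] crossing_width_le[OF assms]
  by (intro weighted_sum_le) auto

lemma crossing_family_empty: "crossing_family \<gamma> a b u x \<mu> {} J P Q"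
  by (simp add: crossing_family_def)

lemma crossing_sup_upper:
  assumes "crossing_family \<gamma> a b u x \<mu> K J P Q"
  shows "crossing_sum \<gamma> u K P Q \<le> crossing_sup \<gamma> a b u x \<mu>"
  unfolding crossing_sup_def
  by (rule cSup_upper) (use assms crossing_sum_le in \<open>auto intro!: bdd_aboveI\<close>)

lemma crossing_sup_least:
  assumes "\<And>K J P Q. crossing_family \<gamma> a b u x \<mu> K J P Q \<Longrightarrow> crossing_sum \<gamma> u K P Q \<le> B"
  shows "crossing_sup \<gamma> a b u x \<mu> \<le> B"
  unfolding crossing_sup_def
proof (rule cSup_least)
  have "crossing_sum \<gamma> u {} (\<lambda>_. 0) (\<lambda>_. 0)
      \<in> {crossing_sum \<gamma> u K P Q |K J P Q. crossing_family \<gamma> a b u x \<mu> K J P Q}"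
    unfolding mem_Collect_eq 
    by (intro exI[of _ "{}"] exI[of _ "\<lambda>_. 0"] conjI refl crossing_family_empty)
  then show "{crossing_sum \<gamma> u K P Q |K J P Q. crossing_family \<gamma> a b u x \<mu> K J P Q} \<noteq> {}"
    by (metis empty_iff)
qed (clarify, erule assms)

lemma crossing_sup_nonneg: "0 \<le> crossing_sup \<gamma> a b u x \<mu>"
  using crossing_sup_upper[OF crossing_family_empty] by (simp add: crossing_sum_def)

lemma crossing_sup_le: "crossing_sup \<gamma> a b u x \<mu> \<le> 2 * \<bar>\<mu>\<bar>"
  by (intro crossing_sup_least crossing_sum_le)

lemma crossing_sup_mono:
  assumes "b \<le> c"
  shows "crossing_sup \<gamma> a b u x \<mu> \<le> crossing_sup \<gamma> a c u x \<mu>"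
proof (rule crossing_sup_least)
  fix K J P Q assume F: "crossing_family \<gamma> a b u x \<mu> K J P Q"
  have "crossing_family \<gamma> a c u x \<mu> K J P Q"
    using F order_refl
  proof (rule crossing_family_shrink)
    show "P k \<le> P k \<and> P k \<le> Q k \<and> Q k \<le> Q k \<and> a \<le> P k \<and> Q k \<le> c" if "k \<in> K" for k
      using crossing_familyD[OF F that] assms by simp
  qed
  then show "crossing_sum \<gamma> u K P Q \<le> crossing_sup \<gamma> a c u x \<mu>"
    by (rule crossing_sup_upper)
qed

text \<open>Cutting the intervals of a family off at \<open>b\<close> costs each of them at most
  \<open>2 * e\<close> of width, and the weights add up to at most 2.\<close>

lemma crossing_sup_le_add:
  assumes "a \<le> b" "b \<le> c" "0 \<le> e" and osc: "\<And>s. s \<in> {b..c} \<Longrightarrow> \<bar>(\<gamma> s - \<gamma> b) \<bullet> u\<bar> \<le> e"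
  shows "crossing_sup \<gamma> a c u x \<mu> \<le> crossing_sup \<gamma> a b u x \<mu> + 4 * e"
proof (rule crossing_sup_least)
  fix K J P Q assume F: "crossing_family \<gamma> a c u x \<mu> K J P Q"
  define K' where "K' = {k \<in> K. P k \<le> b}"
  define Q' where "Q' k = min (Q k) b" for k
  define h where "h k = \<bar>(\<gamma> (Q k) - \<gamma> (P k)) \<bullet> u\<bar>" for k
  \<comment> \<open>Intervals that start after \<open>b\<close> are dropped and count 0; at both of
    their end points the path is within \<open>e\<close> of its value at \<open>b\<close> in
    direction \<open>u\<close>.\<close>
  define h' where "h' k = (if k \<in> K' then \<bar>(\<gamma> (Q' k) - \<gamma> (P k)) \<bullet> u\<bar> else 0)" for k
  have F': "crossing_family \<gamma> a b u x \<mu> K' J P Q'"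
    using F by (rule crossing_family_shrink) (auto simp: K'_def Q'_def crossing_familyD[OF F])
  have le: "h k - h' k \<le> 2 * e" if k: "k \<in> K" for k
  proof -
    note D = crossing_familyD[OF F k]
    consider "Q k \<le> b" | "P k \<le> b" "b < Q k" | "b < P k"
      by linarith
    then show ?thesis
    proof cases
      case 1
      then show ?thesis
        using D k \<open>0 \<le> e\<close> by (simp add: h_def h'_def K'_def Q'_def)
    next
      case 2
      then have "h' k = \<bar>(\<gamma> b - \<gamma> (P k)) \<bullet> u\<bar>"
        using k by (simp add: h'_def K'_def Q'_def)
      then show ?thesis
        using osc[of "Q k"] D 2 \<open>0 \<le> e\<close> by (auto simp: h_def inner_diff_left)
    next
      case 3
      then show ?thesis
        using osc[of "P k"] osc[of "Q k"] D by (auto simp: h_def h'_def K'_def inner_diff_left)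
    qed
  qed
  have fin: "finite K"
    using F by (rule crossing_family_finite)
  have "crossing_sum \<gamma> u K P Q = (\<Sum>k\<in>K. (1/2) ^ k * h' k) + (\<Sum>k\<in>K. (1/2) ^ k * (h k - h' k))"
    by (simp add: crossing_sum_def h_def flip: sum.distrib distrib_left)
  also have "(\<Sum>k\<in>K. (1/2) ^ k * h' k) = crossing_sum \<gamma> u K' P Q'"
    unfolding crossing_sum_def using fin
    by (intro sum.mono_neutral_cong_right) (auto simp: h'_def K'_def)
  also have "\<dots> \<le> crossing_sup \<gamma> a b u x \<mu>"
    using F' by (rule crossing_sup_upper)
  also have "(\<Sum>k\<in>K. (1/2) ^ k * (h k - h' k)) \<le> 2 * (2 * e)"
    using fin le \<open>0 \<le> e\<close> by (intro weighted_sum_le) auto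
  finally show "crossing_sum \<gamma> u K P Q \<le> crossing_sup \<gamma> a b u x \<mu> + 4 * e"
    by simp
qed

section \<open>Counting wide crossings and creating new ones\<close>

lemma slab_even_disjoint:
  assumes "0 < \<mu>" "z \<in> slab u x \<mu> i" "z \<in> slab u x \<mu> j" "even i = even j"
  shows "i = j"
proof -
  have "\<mu> * (of_int i + x) \<le> \<mu> * (of_int j + 1 + x)" "\<mu> * (of_int j + x) \<le> \<mu> * (of_int i + 1 + x)"
    using assms(2,3) by (auto simp: slab_def)
  \<comment> \<open>A common point only forces the indices to differ by at most 1, as neighbouring
    slabs share a face; equal parity then leaves only equality.\<close>
  then have "of_int i \<le> (of_int (j + 1) :: real)" "of_int j \<le> (of_int (i + 1) :: real)"
    using \<open>0 < \<mu>\<close> by auto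
  then have "i \<le> j + 1" "j \<le> i + 1"
    unfolding of_int_le_iff by auto
  then show ?thesis
    using assms(4) by presburger
qed

text \<open>Slabs of the same parity are disjoint, so each parity contributes a disjoint family of intervals.\<close>

lemma card_large_crossings_le:
  fixes \<gamma> :: "real \<Rightarrow> 'a::euclidean_space"
  assumes few: "few_oscillations \<gamma> \<eta> N" and \<gamma>: "path \<gamma>" and "0 \<le> a" "b \<le> 1" "0 < \<mu>" "norm u = 1"
    and F: "crossing_family \<gamma> a b u x \<mu> K J P Q"
    and large: "\<And>k. k \<in> K \<Longrightarrow> \<eta> \<le> \<bar>(\<gamma> (Q k) - \<gamma> (P k)) \<bullet> u\<bar>"
  shows "card K \<le> 2 * N"
proof -
  have "card {k \<in> K. even (J k) = e} \<le> N" for e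
  proof -
    define E where "E = {k \<in> K. even (J k) = e}"
    define I where "I k = {P k..Q k}" for k
    \<comment> \<open>Intervals with a common point lie in the same slab by parity, and their hull
      is just their union, which contradicts the separation clause of the family.\<close>
    have disj: "I k \<inter> I l = {}" if kl: "k \<in> E" "l \<in> E" "k \<noteq> l" for k l
    proof (rule ccontr)
      assume "I k \<inter> I l \<noteq> {}"
      then obtain s where s: "s \<in> {P k..Q k}" "s \<in> {P l..Q l}"
        unfolding I_def by blast
      have K: "k \<in> K" "l \<in> K"
        using kl by (auto simp: E_def)
      note sub = crossing_familyD(4)[OF F K(1)] crossing_familyD(4)[OF F K(2)]
      have J: "J k = J l"
      proof (rule slab_even_disjoint[OF \<open>0 < \<mu>\<close>])
        show "\<gamma> s \<in> slab u x \<mu> (J k)" "\<gamma> s \<in> slab u x \<mu> (J l)"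
          using s sub by blast+
      qed (use kl in \<open>simp add: E_def\<close>)
      have hull: "{min (P k) (P l)..max (Q k) (Q l)} \<subseteq> {P k..Q k} \<union> {P l..Q l}"
        using s by auto
      have "\<gamma> ` ({P k..Q k} \<union> {P l..Q l}) \<subseteq> slab u x \<mu> (J k)"
        using sub J by (simp add: image_Un)
      then show False
        using crossing_family_unlinked[OF F K \<open>k \<noteq> l\<close> J] image_mono[OF hull, of \<gamma>] by blast
    qed
    have ne: "P k \<in> I k" if "k \<in> E" for k
      using crossing_familyD(2)[OF F] that by (auto simp: E_def I_def)
    \<comment> \<open>Nonempty disjoint intervals are distinct, so counting intervals counts
      indices.\<close>
    then have inj: "inj_on I E"
      using disj by (intro inj_onI) (metis IntI empty_iff)
    have "disjoint (I ` E)"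
      using disj by (intro pairwise_imageI) (auto simp: disjnt_def)
    moreover have "is_interval A \<and> A \<subseteq> {0..1} \<and> \<eta> \<le> diameter (\<gamma> ` A)" if IE: "A \<in> I ` E" for A
    proof -
      obtain k where k: "k \<in> K" "A = {P k..Q k}"
        using IE unfolding E_def I_def by blast
      note D = crossing_familyD[OF F k(1)]
      have A: "A \<subseteq> {0..1}"
        using D \<open>0 \<le> a\<close> \<open>b \<le> 1\<close> k by auto
      have "\<eta> \<le> \<bar>(\<gamma> (Q k) - \<gamma> (P k)) \<bullet> u\<bar>"
        using large k by simp
      also have "\<dots> \<le> dist (\<gamma> (Q k)) (\<gamma> (P k))"
        using Cauchy_Schwarz_ineq2[of "\<gamma> (Q k) - \<gamma> (P k)" u] \<open>norm u = 1\<close> by (simp add: dist_norm)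
      also have "\<dots> \<le> diameter (\<gamma> ` A)"
        using \<gamma> A D k by (intro diameter_bounded_bound bounded_path_image_subset[of 0 1])
          (auto simp: path_def)
      finally show ?thesis
        using A k by (auto simp: is_interval_cc)
    qed
    ultimately have "card (I ` E) \<le> N"
      using few unfolding few_oscillations_def by blast
    then show ?thesis
      using inj by (simp add: card_image E_def)
  qed
  note this[of True] this[of False]
  moreover have "K = {k \<in> K. even (J k) = True} \<union> {k \<in> K. even (J k) = False}"
    by auto
  then have "card K \<le> card {k \<in> K. even (J k) = True} + card {k \<in> K. even (J k) = False}"
    by (metis card_Un_le)
  ultimately show ?thesis
    by linarith
qed

text \<open>\<open>q\<close> is the first time at which \<open>f\<close> reaches
  \<open>\<beta>\<close>, and \<open>p\<close> is the last time before \<open>q\<close> at which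
  \<open>f\<close> is at most \<open>\<alpha>\<close>; in between both bounds hold. The intermediate
  value theorem turns the inequalities at \<open>p\<close> and \<open>q\<close> into
  equalities.\<close>

lemma crossing_interval_exists:
  fixes f :: "real \<Rightarrow> real"
  assumes f: "continuous_on {b..c} f" and "b \<le> c" "f b \<le> \<alpha>" "\<alpha> < \<beta>" "\<beta> \<le> f c"
  obtains p q where "b \<le> p" "p \<le> q" "q \<le> c" "f p = \<alpha>" "f q = \<beta>" "\<And>s. s \<in> {p..q} \<Longrightarrow> \<alpha> \<le> f s \<and> f s \<le> \<beta>"
proof -
  have "compact ({b..c} \<inter> f -` {\<beta>..})"
    using continuous_closed_preimage[OF f] compact_Int_closed[OF compact_Icc, of "{b..c} \<inter> f -` {\<beta>..}" b c]
    by (simp add: Int_assoc[symmetric])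
  moreover have "c \<in> {b..c} \<inter> f -` {\<beta>..}"
    using assms by simp
  ultimately obtain q where "q \<in> {b..c} \<inter> f -` {\<beta>..}" "\<forall>s\<in>{b..c} \<inter> f -` {\<beta>..}. q \<le> s"
    using compact_attains_inf by blast
  then have q: "q \<in> {b..c}" "\<beta> \<le> f q" "\<And>s. s \<in> {b..c} \<Longrightarrow> \<beta> \<le> f s \<Longrightarrow> q \<le> s"
    by simp_all
  have fq: "continuous_on {b..q} f"
    using f q by (auto intro: continuous_on_subset)
  obtain s where "b \<le> s" "s \<le> q" "f s = \<beta>"
    using IVT'[of f b \<beta> q] fq q assms by auto
  then have fq_eq: "f q = \<beta>"
    using q(1) q(3)[of s] by auto
  have "compact ({b..q} \<inter> f -` {..\<alpha>})"
    using continuous_closed_preimage[OF fq] compact_Int_closed[OF compact_Icc, of "{b..q} \<inter> f -` {..\<alpha>}" b q]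
    by (simp add: Int_assoc[symmetric])
  moreover have "b \<in> {b..q} \<inter> f -` {..\<alpha>}"
    using assms q by simp
  ultimately obtain p where "p \<in> {b..q} \<inter> f -` {..\<alpha>}" "\<forall>s\<in>{b..q} \<inter> f -` {..\<alpha>}. s \<le> p"
    using compact_attains_sup by blast
  then have p: "p \<in> {b..q}" "f p \<le> \<alpha>" "\<And>s. s \<in> {b..q} \<Longrightarrow> f s \<le> \<alpha> \<Longrightarrow> s \<le> p"
    by simp_all
  have fp: "continuous_on {p..q} f"
    using fq p by (auto intro: continuous_on_subset)
  obtain s where "p \<le> s" "s \<le> q" "f s = \<alpha>"
    using IVT'[of f p \<alpha> q] fp q p assms by auto
  then have fp_eq: "f p = \<alpha>"
    using p(1) p(3)[of s] by auto
  show ?thesis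
  proof (rule that[OF _ _ _ fp_eq fq_eq])
    show "\<alpha> \<le> f s \<and> f s \<le> \<beta>" if "s \<in> {p..q}" for s
      using that p(1) q(1) p(3)[of s] q(3)[of s] fp_eq fq_eq by fastforce
  qed (use p q in auto)
qed

text \<open>The first slab strictly beyond \<open>\<gamma> b\<close> in the direction of travel
  begins within distance \<open>\<mu>\<close> and has thickness \<open>\<mu>\<close>, so a
  displacement of \<open>2 * \<mu>\<close> crosses it completely. That \<open>\<gamma> b\<close>
  lies outside this slab later separates the new crossing from all old ones.\<close>

lemma new_crossing_exists:
  fixes \<gamma> :: "real \<Rightarrow> 'a::euclidean_space"
  assumes \<gamma>: "continuous_on {b..c} \<gamma>" and "b \<le> c" "0 < \<mu>" and long: "2 * \<mu> \<le> \<bar>(\<gamma> c - \<gamma> b) \<bullet> u\<bar>"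
  obtains j p q where "b \<le> p" "p \<le> q" "q \<le> c" "\<gamma> ` {p..q} \<subseteq> slab u x \<mu> j"
    "\<bar>(\<gamma> q - \<gamma> p) \<bullet> u\<bar> = \<mu>" "\<gamma> b \<notin> slab u x \<mu> j"
proof -
  define f where "f s = \<gamma> s \<bullet> u" for s
  have f: "continuous_on {b..c} f" "continuous_on {b..c} (\<lambda>s. - f s)"
    unfolding f_def using \<gamma> by (auto intro!: continuous_intros)
  consider "f b + 2 * \<mu> \<le> f c" | "f c + 2 * \<mu> \<le> f b"
    using long by (fastforce simp: f_def inner_diff_left abs_if split: if_splits)
  then show ?thesis
  proof cases
    case 1
    \<comment> \<open>Adding 1 to the floor keeps the lower face strictly above \<open>f b\<close>
      even when \<open>f b\<close> lies on a face.\<close>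
    define j where "j = \<lfloor>f b / \<mu> - x\<rfloor> + 1"
    have "f b / \<mu> < of_int j + x" "of_int j + x \<le> f b / \<mu> + 1"
      unfolding j_def by linarith+
    then have j: "f b < \<mu> * (of_int j + x)" "\<mu> * (of_int j + x) \<le> f b + \<mu>"
      using \<open>0 < \<mu>\<close> by (auto simp: field_simps)
    have eq: "\<mu> * (of_int j + 1 + x) = \<mu> * (of_int j + x) + \<mu>"
      by (simp add: algebra_simps)
    obtain p q where pq: "b \<le> p" "p \<le> q" "q \<le> c" "f p = \<mu> * (of_int j + x)" "f q = \<mu> * (of_int j + 1 + x)"
      "\<And>s. s \<in> {p..q} \<Longrightarrow> \<mu> * (of_int j + x) \<le> f s \<and> f s \<le> \<mu> * (of_int j + 1 + x)"
      using crossing_interval_exists[OF f(1) \<open>b \<le> c\<close>, of "\<mu> * (of_int j + x)" "\<mu> * (of_int j + 1 + x)"]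
        j 1 \<open>0 < \<mu>\<close> unfolding eq by (smt (verit))
    show ?thesis
      by (rule that[of p q j]) (use pq j eq \<open>0 < \<mu>\<close> in \<open>auto simp: f_def slab_def inner_diff_left\<close>)
  next
    case 2
    \<comment> \<open>Mirror image: the upper face has index \<open>j + 1\<close>, the greatest one
      strictly below \<open>f b\<close>.\<close>
    define j where "j = \<lceil>f b / \<mu> - x\<rceil> - 2"
    have "of_int j + 1 + x < f b / \<mu>" "f b / \<mu> - 1 \<le> of_int j + 1 + x"
      unfolding j_def by linarith+
    then have j: "\<mu> * (of_int j + 1 + x) < f b" "f b - \<mu> \<le> \<mu> * (of_int j + 1 + x)"
      using \<open>0 < \<mu>\<close> by (auto simp: field_simps)
    have eq: "\<mu> * (of_int j + 1 + x) = \<mu> * (of_int j + x) + \<mu>"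
      by (simp add: algebra_simps)
    obtain p q where pq: "b \<le> p" "p \<le> q" "q \<le> c" "- f p = - (\<mu> * (of_int j + 1 + x))" "- f q = - (\<mu> * (of_int j + x))"
      "\<And>s. s \<in> {p..q} \<Longrightarrow> - (\<mu> * (of_int j + 1 + x)) \<le> - f s \<and> - f s \<le> - (\<mu> * (of_int j + x))"
      using crossing_interval_exists[OF f(2) \<open>b \<le> c\<close>, of "- (\<mu> * (of_int j + 1 + x))" "- (\<mu> * (of_int j + x))"]
        j 2 \<open>0 < \<mu>\<close> unfolding eq by (smt (verit))
    have in_slab: "\<mu> * (of_int j + x) \<le> f s \<and> f s \<le> \<mu> * (of_int j + 1 + x)" if "s \<in> {p..q}" for s
      using pq(6)[OF that] by simp
    show ?thesis
      by (rule that[of p q j]) (use pq(1-5) in_slab j eq \<open>0 < \<mu>\<close> in \<open>auto simp: f_def slab_def inner_diff_left\<close>)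
  qed
qed

text \<open>
  The new crossing takes the least index \<open>m\<close> that carries no crossing of width at least \<open>\<mu> / 2\<close>.
  There are at most \<open>2 * N\<close> such wide crossings, hence \<open>m \<le> 2 * N\<close>, and the crossing displaced
  from \<open>m\<close>, if any, has width less than \<open>\<mu> / 2\<close>.
\<close>

lemma crossing_sup_increment:
  fixes \<gamma> :: "real \<Rightarrow> 'a::euclidean_space"
  assumes \<gamma>: "path \<gamma>" and few: "few_oscillations \<gamma> \<eta> N" and "\<eta> \<le> \<mu> / 2"
    and abc: "0 \<le> a" "a \<le> b" "b \<le> c" "c \<le> 1" and "0 < \<mu>" "norm u = 1"
    and long: "2 * \<mu> \<le> \<bar>(\<gamma> c - \<gamma> b) \<bullet> u\<bar>"
  shows "crossing_sup \<gamma> a b u x \<mu> + (1/2) ^ (2 * N) * (\<mu> / 2) \<le> crossing_sup \<gamma> a c u x \<mu>"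
proof -
  define d where "d = (1/2) ^ (2 * N) * (\<mu> / 2)"
  have "continuous_on {b..c} \<gamma>"
    using \<gamma> abc by (auto simp: path_def intro: continuous_on_subset)
  then obtain j p q where new: "b \<le> p" "p \<le> q" "q \<le> c" "\<gamma> ` {p..q} \<subseteq> slab u x \<mu> j"
      "\<bar>(\<gamma> q - \<gamma> p) \<bullet> u\<bar> = \<mu>" "\<gamma> b \<notin> slab u x \<mu> j"
    using new_crossing_exists[OF _ abc(3) \<open>0 < \<mu>\<close> long] by metis
  have "crossing_sup \<gamma> a b u x \<mu> \<le> crossing_sup \<gamma> a c u x \<mu> - d"
  proof (rule crossing_sup_least)
    fix K J P Q assume F: "crossing_family \<gamma> a b u x \<mu> K J P Q"
    have fin: "finite K"
      using F by (rule crossing_family_finite)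
    define B where "B = {k \<in> K. \<mu> / 2 \<le> \<bar>(\<gamma> (Q k) - \<gamma> (P k)) \<bullet> u\<bar>}"
    have "finite B"
      using fin by (simp add: B_def)
    have "crossing_family \<gamma> a b u x \<mu> B J P Q"
      using F by (rule crossing_family_shrink) (auto simp: B_def crossing_familyD[OF F])
    from _ \<open>0 < \<mu>\<close> \<open>norm u = 1\<close> this have "card B \<le> 2 * N"
      by (rule card_large_crossings_le[OF few \<gamma> \<open>0 \<le> a\<close>])
        (use abc \<open>\<eta> \<le> \<mu> / 2\<close> in \<open>auto simp: B_def\<close>)
    define m where "m = (LEAST k. k \<notin> B)"
    have "m \<notin> B"
      unfolding m_def using \<open>finite B\<close> ex_new_if_finite[OF infinite_UNIV_nat] by (metis LeastI)
    have "{..<m} \<subseteq> B"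
      unfolding m_def using not_less_Least by blast
    then have "m \<le> 2 * N"
      using card_mono[OF \<open>finite B\<close>, of "{..<m}"] \<open>card B \<le> 2 * N\<close> by simp
    define J' P' Q' where "J' = J(m := j)" and "P' = P(m := p)" and "Q' = Q(m := q)"
    have "crossing_family \<gamma> a c u x \<mu> (insert m K) J' P' Q'"
    proof -
      \<comment> \<open>Every old interval ends by \<open>b\<close> and the new one starts no
        earlier than \<open>b\<close>, so each hull contains \<open>b\<close>, where the path is
        outside slab \<open>j\<close>.\<close>
      have unlinked: "\<not> \<gamma> ` {min (P k) p..max (Q k) q} \<subseteq> slab u x \<mu> j"
        "\<not> \<gamma> ` {min p (P k)..max q (Q k)} \<subseteq> slab u x \<mu> j" if "k \<in> K" for k
      proof -
        have "b \<in> {min (P k) p..max (Q k) q}" "b \<in> {min p (P k)..max q (Q k)}"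
          using crossing_familyD[OF F that] new by auto
        then show "\<not> \<gamma> ` {min (P k) p..max (Q k) q} \<subseteq> slab u x \<mu> j"
          "\<not> \<gamma> ` {min p (P k)..max q (Q k)} \<subseteq> slab u x \<mu> j"
          using new(6) by blast+
      qed
      have old: "a \<le> P k \<and> P k \<le> Q k \<and> Q k \<le> c \<and> \<gamma> ` {P k..Q k} \<subseteq> slab u x \<mu> (J k)" if "k \<in> K" for k
        using crossing_familyD[OF F that] abc by auto
      show ?thesis
        unfolding crossing_family_def J'_def P'_def Q'_def
      proof (intro conjI ballI impI)
        show "finite (insert m K)"
          using fin by simp
      next
        fix k l assume kl: "k \<in> insert m K" "l \<in> insert m K" "k \<noteq> l" "(J(m := j)) k = (J(m := j)) l"
        consider "k = m" "l \<noteq> m" | "k \<noteq> m" "l = m" | "k \<noteq> m" "l \<noteq> m"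
          using kl(3) by blast
        then show "\<not> \<gamma> ` {min ((P(m := p)) k) ((P(m := p)) l)..max ((Q(m := q)) k) ((Q(m := q)) l)}
            \<subseteq> slab u x \<mu> ((J(m := j)) k)"
        proof cases
          case 1
          then show ?thesis
            using unlinked(2)[of l] kl by (simp del: image_subset_iff)
        next
          case 2
          then show ?thesis
            using unlinked(1)[of k] kl by (simp del: image_subset_iff)
        next
          case 3
          then show ?thesis
            using crossing_family_unlinked[OF F, of k l] kl by (simp del: image_subset_iff)
        qed
      next
        fix k assume "k \<in> insert m K"
        then show "a \<le> (P(m := p)) k" "(P(m := p)) k \<le> (Q(m := q)) k" "(Q(m := q)) k \<le> c"
          "\<gamma> ` {(P(m := p)) k..(Q(m := q)) k} \<subseteq> slab u x \<mu> ((J(m := j)) k)"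
          using old[of k] new abc by (cases "k = m"; simp)+
      qed
    qed
    then have "crossing_sum \<gamma> u (insert m K) P' Q' \<le> crossing_sup \<gamma> a c u x \<mu>"
      by (rule crossing_sup_upper)
    moreover have "crossing_sum \<gamma> u (insert m K) P' Q' = (1/2) ^ m * \<mu> + crossing_sum \<gamma> u (K - {m}) P Q"
      unfolding crossing_sum_def using fin new
      by (subst sum.insert_remove) (auto simp: P'_def Q'_def intro!: sum.cong)
    \<comment> \<open>Placing the new crossing at \<open>m\<close> adds
      \<open>(1/2) ^ m * \<mu>\<close>, and a term displaced from there is at most half of that
      because \<open>m\<close> is not in \<open>B\<close>.\<close>
    moreover have "crossing_sum \<gamma> u K P Q \<le> (1/2) ^ m * (\<mu> / 2) + crossing_sum \<gamma> u (K - {m}) P Q"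
    proof (cases "m \<in> K")
      case True
      then have "\<bar>(\<gamma> (Q m) - \<gamma> (P m)) \<bullet> u\<bar> \<le> \<mu> / 2"
        using \<open>m \<notin> B\<close> by (auto simp: B_def)
      then show ?thesis
        unfolding crossing_sum_def using fin True
        by (subst sum.remove[of K m]) (auto intro!: mult_left_mono)
    qed (use \<open>0 < \<mu>\<close> in simp)
    moreover have "d \<le> (1/2) ^ m * (\<mu> / 2)"
      unfolding d_def using \<open>0 < \<mu>\<close> \<open>m \<le> 2 * N\<close> by (intro mult_right_mono power_decreasing) auto
    moreover have "(1/2) ^ m * \<mu> = (1/2) ^ m * (\<mu> / 2) + (1/2) ^ m * (\<mu> / 2)"
      by simp
    ultimately show "crossing_sum \<gamma> u K P Q \<le> crossing_sup \<gamma> a c u x \<mu> - d"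
      by linarith
  qed
  then show ?thesis
    by (simp add: d_def)
qed

section \<open>The weighted sum over slab components as a supremum\<close>

lemma slab_component_width:
  fixes \<gamma> :: "real \<Rightarrow> 'a::euclidean_space"
  assumes \<gamma>: "continuous_on {a..b} \<gamma>" and C: "C \<subseteq> {a..b}" and pq: "p \<in> C" "q \<in> C"
  shows "\<bar>(\<gamma> q - \<gamma> p) \<bullet> u\<bar> \<le> width u (\<gamma> ` C)"
proof -
  have "continuous_on {a..b} (\<lambda>s. \<gamma> s \<bullet> u)"
    using \<gamma> by (intro continuous_intros)
  then have "bounded ((\<lambda>s. \<gamma> s \<bullet> u) ` C)"
    using C by (rule bounded_path_image_subset)
  then have "dist (\<gamma> q \<bullet> u) (\<gamma> p \<bullet> u) \<le> diameter ((\<lambda>s. \<gamma> s \<bullet> u) ` C)"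
    using pq by (intro diameter_bounded_bound) auto
  then show ?thesis
    by (simp add: width_def image_image dist_real_def inner_diff_left)
qed

lemma slab_component_crossing:
  fixes \<gamma> :: "real \<Rightarrow> 'a::euclidean_space"
  assumes \<gamma>: "continuous_on {a..b} \<gamma>" and C: "C \<in> slab_components \<gamma> a b u x \<mu>" and "0 < \<eta>"
  obtains j p q where "C \<in> components ({a..b} \<inter> \<gamma> -` slab u x \<mu> j)" "p \<in> C" "q \<in> C" "p \<le> q"
    "width u (\<gamma> ` C) - \<eta> < \<bar>(\<gamma> q - \<gamma> p) \<bullet> u\<bar>"
proof -
  obtain j where j: "C \<in> components ({a..b} \<inter> \<gamma> -` slab u x \<mu> j)" and pos: "0 < width u (\<gamma> ` C)"
    using C by (auto simp: slab_components_def)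
  have sub: "C \<subseteq> {a..b}"
    using in_components_subset[OF j] by auto
  have "continuous_on {a..b} (\<lambda>s. \<gamma> s \<bullet> u)"
    using \<gamma> by (intro continuous_intros)
  then have bnd: "bounded ((\<lambda>s. \<gamma> s \<bullet> u) ` C)"
    using sub by (rule bounded_path_image_subset)
  define w where "w = width u (\<gamma> ` C)"
  have "w = diameter ((\<lambda>s. \<gamma> s \<bullet> u) ` C)"
    by (simp add: w_def width_def image_image)
  \<comment> \<open>The alternative \<open>w / 2\<close> keeps the threshold positive when
    \<open>\<eta>\<close> exceeds \<open>w\<close>, as \<open>diameter_lower_bounded\<close>
    requires.\<close>
  then obtain p q where pq: "p \<in> C" "q \<in> C" "max (w - \<eta>) (w / 2) < dist (\<gamma> p \<bullet> u) (\<gamma> q \<bullet> u)"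
    using diameter_lower_bounded[OF bnd, of "max (w - \<eta>) (w / 2)"] pos \<open>0 < \<eta>\<close>
    by (auto simp: w_def less_max_iff_disj)
  then have lt: "w - \<eta> < \<bar>(\<gamma> q - \<gamma> p) \<bullet> u\<bar>" "w - \<eta> < \<bar>(\<gamma> p - \<gamma> q) \<bullet> u\<bar>"
    by (auto simp: dist_real_def inner_diff_left)
  show ?thesis
  proof (cases "p \<le> q")
    case True
    then show ?thesis
      using that[OF j pq(1,2)] lt by (simp add: w_def)
  next
    case False
    then show ?thesis
      using that[OF j pq(2,1)] lt by (simp add: w_def)
  qed
qed

text \<open>Each component supplies one nearly extremal pair of points. If the hull of two such
  pairs stayed in their common slab, it would be a connected set meeting both components, so these
  would coincide, against the injectivity of \<open>C\<close>.\<close>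

lemma slab_components_crossing_family:
  fixes \<gamma> :: "real \<Rightarrow> 'a::euclidean_space"
  assumes \<gamma>: "continuous_on {a..b} \<gamma>" and "finite K" "inj_on C K"
    and C: "C ` K \<subseteq> slab_components \<gamma> a b u x \<mu>" and "0 < \<eta>"
  obtains J P Q where "crossing_family \<gamma> a b u x \<mu> K J P Q"
    and "\<And>k. k \<in> K \<Longrightarrow> width u (\<gamma> ` C k) - \<eta> < \<bar>(\<gamma> (Q k) - \<gamma> (P k)) \<bullet> u\<bar>"
proof -
  have "\<forall>k\<in>K. \<exists>j p q. C k \<in> components ({a..b} \<inter> \<gamma> -` slab u x \<mu> j) \<and> p \<in> C k \<and> q \<in> C k \<and> p \<le> q \<and>
      width u (\<gamma> ` C k) - \<eta> < \<bar>(\<gamma> q - \<gamma> p) \<bullet> u\<bar>"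
  proof
    fix k assume "k \<in> K"
    then have "C k \<in> slab_components \<gamma> a b u x \<mu>"
      using C by blast
    from slab_component_crossing[OF \<gamma> this \<open>0 < \<eta>\<close>]
    show "\<exists>j p q. C k \<in> components ({a..b} \<inter> \<gamma> -` slab u x \<mu> j) \<and> p \<in> C k \<and> q \<in> C k \<and> p \<le> q \<and>
        width u (\<gamma> ` C k) - \<eta> < \<bar>(\<gamma> q - \<gamma> p) \<bullet> u\<bar>"
      by metis
  qed
  then obtain J P Q where JPQ: "\<And>k. k \<in> K \<Longrightarrow> C k \<in> components ({a..b} \<inter> \<gamma> -` slab u x \<mu> (J k))"
      "\<And>k. k \<in> K \<Longrightarrow> P k \<in> C k" "\<And>k. k \<in> K \<Longrightarrow> Q k \<in> C k" "\<And>k. k \<in> K \<Longrightarrow> P k \<le> Q k"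
      "\<And>k. k \<in> K \<Longrightarrow> width u (\<gamma> ` C k) - \<eta> < \<bar>(\<gamma> (Q k) - \<gamma> (P k)) \<bullet> u\<bar>"
    by metis
  have sub: "{P k..Q k} \<subseteq> C k" if "k \<in> K" for k
    using in_components_connected[OF JPQ(1)[OF that]] JPQ(2,3)[OF that]
    by (simp add: connected_contains_Icc)
  have slab: "C k \<subseteq> {a..b}" "C k \<subseteq> \<gamma> -` slab u x \<mu> (J k)" if "k \<in> K" for k
    using in_components_subset[OF JPQ(1)[OF that]] by auto
  have "crossing_family \<gamma> a b u x \<mu> K J P Q"
    unfolding crossing_family_def
  proof (intro conjI ballI impI notI)
    fix k assume k: "k \<in> K"
    show "a \<le> P k" "P k \<le> Q k" "Q k \<le> b" "\<gamma> ` {P k..Q k} \<subseteq> slab u x \<mu> (J k)"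
      using slab[OF k] sub[OF k] JPQ(2-4)[OF k] by auto
    fix l assume l: "l \<in> K" "k \<noteq> l" "J k = J l"
      and hull: "\<gamma> ` {min (P k) (P l)..max (Q k) (Q l)} \<subseteq> slab u x \<mu> (J k)"
    define T where "T = {min (P k) (P l)..max (Q k) (Q l)}"
    have "P k \<in> T" "P l \<in> T"
      using JPQ(4)[OF k] JPQ(4)[OF l(1)] by (auto simp: T_def)
    moreover have "T \<subseteq> {a..b}"
      using slab(1)[OF k] slab(1)[OF l(1)] JPQ(2,3)[OF k] JPQ(2,3)[OF l(1)] by (auto simp: T_def)
    then have "T \<subseteq> {a..b} \<inter> \<gamma> -` slab u x \<mu> (J k)"
      using hull by (auto simp: T_def)
    moreover have "connected T"
      by (simp add: T_def)
    ultimately have "C k = C l"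
      using joinable_components_eq[of T _ "C k" "C l"] JPQ(1,2)[OF k] JPQ(1,2)[OF l(1)] l(3)
      by (metis disjoint_iff)
    then show False
      using \<open>inj_on C K\<close> k l by (auto dest: inj_onD)
  qed fact
  then show ?thesis
    using JPQ(5) by (rule that)
qed

text \<open>Infinitely many would include \<open>2 * N + 1\<close> components, and these give as
  many crossings of width at least \<open>\<epsilon> / 2\<close>, more than the parity count allows.
  The half absorbs the approximation of widths.\<close>

lemma finite_wide_slab_components:
  fixes \<gamma> :: "real \<Rightarrow> 'a::euclidean_space"
  assumes \<gamma>: "path \<gamma>" and "0 \<le> a" "b \<le> 1" "0 < \<mu>" "norm u = 1" "0 < \<epsilon>"
  shows "finite {C \<in> slab_components \<gamma> a b u x \<mu>. \<epsilon> \<le> width u (\<gamma> ` C)}"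
proof (rule ccontr)
  assume inf: "infinite {C \<in> slab_components \<gamma> a b u x \<mu>. \<epsilon> \<le> width u (\<gamma> ` C)}"
  have cont: "continuous_on {a..b} \<gamma>"
    using \<gamma> assms(2,3) by (auto simp: path_def intro: continuous_on_subset)
  obtain N where N: "few_oscillations \<gamma> (\<epsilon> / 2) N"
    using path_few_oscillations[OF \<gamma>, of "\<epsilon> / 2"] \<open>0 < \<epsilon>\<close> by auto
  obtain S where S: "finite S" "card S = Suc (2 * N)"
      "S \<subseteq> {C \<in> slab_components \<gamma> a b u x \<mu>. \<epsilon> \<le> width u (\<gamma> ` C)}"
    using infinite_arbitrarily_large[OF inf] by metis
  obtain C where "bij_betw C {..<Suc (2 * N)} S"
    using S by (metis bij_betw_iff_card card_lessThan finite_lessThan)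
  then have inj: "inj_on C {..<Suc (2 * N)}" and img: "C ` {..<Suc (2 * N)} = S"
    by (auto simp: bij_betw_def)
  have "C ` {..<Suc (2 * N)} \<subseteq> slab_components \<gamma> a b u x \<mu>"
    using S(3) img by blast
  then obtain J P Q where F: "crossing_family \<gamma> a b u x \<mu> {..<Suc (2 * N)} J P Q"
      and w: "\<And>k. k \<in> {..<Suc (2 * N)} \<Longrightarrow> width u (\<gamma> ` C k) - \<epsilon> / 2 < \<bar>(\<gamma> (Q k) - \<gamma> (P k)) \<bullet> u\<bar>"
    using slab_components_crossing_family[OF cont finite_lessThan inj, of u x \<mu> "\<epsilon> / 2"] \<open>0 < \<epsilon>\<close>
    by (metis half_gt_zero)
  have "card {..<Suc (2 * N)} \<le> 2 * N"
  proof (rule card_large_crossings_le[OF N \<gamma> assms(2-5) F])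
    fix k assume k: "k \<in> {..<Suc (2 * N)}"
    then have "\<epsilon> \<le> width u (\<gamma> ` C k)"
      using S(3) img by blast
    then show "\<epsilon> / 2 \<le> \<bar>(\<gamma> (Q k) - \<gamma> (P k)) \<bullet> u\<bar>"
      using w[OF k] by linarith
  qed
  then show False
    by simp
qed

text \<open>Each interval goes to the component that contains it. Two intervals sharing a component
  would either belong to the same slab, and then their hull stays inside it, or to different slabs,
  and then the component lies in both and has width 0.\<close>

lemma crossing_family_slab_components:
  fixes \<gamma> :: "real \<Rightarrow> 'a::euclidean_space"
  assumes \<gamma>: "continuous_on {a..b} \<gamma>" and "0 < \<mu>" and F: "crossing_family \<gamma> a b u x \<mu> K J P Q"
    and pos: "\<And>k. k \<in> K \<Longrightarrow> (\<gamma> (Q k) - \<gamma> (P k)) \<bullet> u \<noteq> 0"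
  obtains \<phi> where "inj_on \<phi> K" "\<phi> ` K \<subseteq> slab_components \<gamma> a b u x \<mu>"
    "\<And>k. k \<in> K \<Longrightarrow> \<bar>(\<gamma> (Q k) - \<gamma> (P k)) \<bullet> u\<bar> \<le> width u (\<gamma> ` \<phi> k)"
proof -
  define S where "S j = {a..b} \<inter> \<gamma> -` slab u x \<mu> j" for j
  have "\<exists>C. C \<in> components (S (J k)) \<and> {P k..Q k} \<subseteq> C" if k: "k \<in> K" for k
  proof (rule exists_component_superset)
    show "{P k..Q k} \<subseteq> S (J k)"
      using crossing_familyD[OF F k] by (auto simp: S_def)
    then show "S (J k) \<noteq> {}"
      using crossing_familyD(2)[OF F k] by auto
  qed simp
  then obtain \<phi> where \<phi>: "\<And>k. k \<in> K \<Longrightarrow> \<phi> k \<in> components (S (J k))" "\<And>k. k \<in> K \<Longrightarrow> {P k..Q k} \<subseteq> \<phi> k"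
    by metis
  have PQ: "P k \<in> \<phi> k" "Q k \<in> \<phi> k" if "k \<in> K" for k
    using \<phi>(2)[OF that] crossing_familyD(2)[OF F that] by auto
  have sub: "\<phi> k \<subseteq> {a..b}" "\<And>s. s \<in> \<phi> k \<Longrightarrow> \<gamma> s \<in> slab u x \<mu> (J k)" if "k \<in> K" for k
    using in_components_subset[OF \<phi>(1)[OF that]] by (auto simp: S_def)
  have width: "\<bar>(\<gamma> (Q k) - \<gamma> (P k)) \<bullet> u\<bar> \<le> width u (\<gamma> ` \<phi> k)" if "k \<in> K" for k
    using \<gamma> sub(1)[OF that] PQ[OF that] by (rule slab_component_width)
  show ?thesis
  proof
    show "inj_on \<phi> K"
    proof (rule inj_onI, rule ccontr)
      fix k l assume kl: "k \<in> K" "l \<in> K" "\<phi> k = \<phi> l" "k \<noteq> l"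
      have "J k \<noteq> J l"
      proof
        assume J: "J k = J l"
        have "min (P k) (P l) \<in> \<phi> k" "max (Q k) (Q l) \<in> \<phi> k"
          using PQ[OF kl(1)] PQ[OF kl(2)] kl(3) by (auto simp: min_def max_def)
        then have "{min (P k) (P l)..max (Q k) (Q l)} \<subseteq> \<phi> k"
          using in_components_connected[OF \<phi>(1)[OF kl(1)]] by (simp add: connected_contains_Icc)
        then show False
          using crossing_family_unlinked[OF F kl(1,2,4) J] sub(2)[OF kl(1)] by blast
      qed
      have "J k < J l \<or> J l < J k"
        using \<open>J k \<noteq> J l\<close> by linarith
      moreover have "\<gamma> s \<bullet> u = \<gamma> t \<bullet> u"
        if "s \<in> \<phi> k" "t \<in> \<phi> k" "i < j" "{J k, J l} = {i, j}" for s t and i j :: int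
      proof -
        have in_slab: "\<gamma> s \<in> slab u x \<mu> i" "\<gamma> s \<in> slab u x \<mu> j" "\<gamma> t \<in> slab u x \<mu> i" "\<gamma> t \<in> slab u x \<mu> j"
          using that sub(2)[OF kl(1)] sub(2)[OF kl(2)] kl(3) by (auto simp: doubleton_eq_iff)
        \<comment> \<open>The upper face of slab \<open>i\<close> is not above the lower face of
          slab \<open>j\<close>, so membership in both fixes the inner product.\<close>
        have "real_of_int (i + 1) \<le> real_of_int j"
          using \<open>i < j\<close> unfolding of_int_le_iff by simp
        then have "\<mu> * (real_of_int i + 1 + x) \<le> \<mu> * (real_of_int j + x)"
          using \<open>0 < \<mu>\<close> by (intro mult_left_mono) auto
        then show ?thesis
          using in_slab by (auto simp: slab_def)
      qed
      ultimately have "\<gamma> (Q k) \<bullet> u = \<gamma> (P k) \<bullet> u"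
        using PQ[OF kl(1)] by (metis insert_commute)
      then show False
        using pos[OF kl(1)] by (simp add: inner_diff_left)
    qed
    have "0 < width u (\<gamma> ` \<phi> k)" if "k \<in> K" for k
      using width[OF that] pos[OF that] by linarith
    then show "\<phi> ` K \<subseteq> slab_components \<gamma> a b u x \<mu>"
      using \<phi>(1) unfolding slab_components_def S_def by blast
  qed (fact width)
qed

text \<open>Partial sums are approximated by families with one interval per component. Conversely, a
  family is sent injectively into the components, and \<open>rearrangement_le\<close> compares it
  with the sorted sum. The right side does not mention the enumeration, so all enumerations give the
  same value.\<close>

lemma slab_enumeration_sum:
  fixes \<gamma> :: "real \<Rightarrow> 'a::euclidean_space"
  assumes \<gamma>: "continuous_on {a..b} \<gamma>" and "0 < \<mu>" and E: "slab_enumeration \<gamma> a b u x \<mu> N C"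
  shows "(\<Sum>k. if enat k < N then (1/2) ^ k * width u (\<gamma> ` C k) else 0) = crossing_sup \<gamma> a b u x \<mu>"
proof -
  define w where "w A = width u (\<gamma> ` A)" for A
  define t where "t k = (if enat k < N then (1/2) ^ k * w (C k) else 0)" for k
  have bij: "bij_betw C {k. enat k < N} (slab_components \<gamma> a b u x \<mu>)"
    and dec: "\<And>k. enat (Suc k) < N \<Longrightarrow> w (C (Suc k)) \<le> w (C k)"
    using E by (auto simp: slab_enumeration_def w_def)
  have pos: "0 \<le> w A" if "A \<in> slab_components \<gamma> a b u x \<mu>" for A
    using that by (auto simp: slab_components_def w_def)
  have t_nonneg: "0 \<le> t k" for k
    using pos bij_betwE[OF bij] by (simp add: t_def)
  have partial: "sum t {..<n} \<le> crossing_sup \<gamma> a b u x \<mu>" for n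
  proof (rule field_le_epsilon)
    fix e :: real assume "0 < e"
    define K where "K = {k. k < n \<and> enat k < N}"
    have K: "finite K" "inj_on C K" "C ` K \<subseteq> slab_components \<gamma> a b u x \<mu>"
      using bij by (auto simp: K_def bij_betw_def intro: inj_on_subset)
    obtain J P Q where F: "crossing_family \<gamma> a b u x \<mu> K J P Q"
        and le: "\<And>k. k \<in> K \<Longrightarrow> width u (\<gamma> ` C k) - e / 2 < \<bar>(\<gamma> (Q k) - \<gamma> (P k)) \<bullet> u\<bar>"
      using slab_components_crossing_family[OF \<gamma> K, of "e / 2"] \<open>0 < e\<close> by auto
    have diff: "w (C k) - \<bar>(\<gamma> (Q k) - \<gamma> (P k)) \<bullet> u\<bar> \<le> e / 2" if "k \<in> K" for k
      using le[OF that] by (simp add: w_def)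
    have "sum t {..<n} = (\<Sum>k\<in>K. (1/2) ^ k * w (C k))"
      by (intro sum.mono_neutral_cong_right) (auto simp: K_def t_def)
    also have "\<dots> = crossing_sum \<gamma> u K P Q + (\<Sum>k\<in>K. (1/2) ^ k * (w (C k) - \<bar>(\<gamma> (Q k) - \<gamma> (P k)) \<bullet> u\<bar>))"
      by (simp add: crossing_sum_def flip: sum.distrib distrib_left)
    also have "\<dots> \<le> crossing_sup \<gamma> a b u x \<mu> + 2 * (e / 2)"
      using crossing_sup_upper[OF F] diff K(1) \<open>0 < e\<close>
      by (intro add_mono weighted_sum_le) simp_all
    finally show "sum t {..<n} \<le> crossing_sup \<gamma> a b u x \<mu> + e"
      by simp
  qed
  have summable: "summable t"
    using t_nonneg partial by (intro summableI_nonneg_bounded)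
  have "suminf t \<le> crossing_sup \<gamma> a b u x \<mu>"
    using summable partial by (rule suminf_le_const)
  moreover have "crossing_sup \<gamma> a b u x \<mu> \<le> suminf t"
  proof (rule crossing_sup_least)
    fix K J P Q assume F: "crossing_family \<gamma> a b u x \<mu> K J P Q"
    \<comment> \<open>Crossings of zero width contribute nothing, but they may lie in components of
      zero width, which are not enumerated.\<close>
    define K' where "K' = {k \<in> K. (\<gamma> (Q k) - \<gamma> (P k)) \<bullet> u \<noteq> 0}"
    have F': "crossing_family \<gamma> a b u x \<mu> K' J P Q"
      using F by (rule crossing_family_shrink) (auto simp: K'_def crossing_familyD[OF F])
    obtain \<phi> where \<phi>: "inj_on \<phi> K'" "\<phi> ` K' \<subseteq> slab_components \<gamma> a b u x \<mu>"
        and le: "\<And>k. k \<in> K' \<Longrightarrow> \<bar>(\<gamma> (Q k) - \<gamma> (P k)) \<bullet> u\<bar> \<le> w (\<phi> k)"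
      using crossing_family_slab_components[OF \<gamma> \<open>0 < \<mu>\<close> F'] unfolding K'_def w_def by blast
    have "crossing_sum \<gamma> u K P Q = crossing_sum \<gamma> u K' P Q"
      unfolding crossing_sum_def using crossing_family_finite[OF F]
      by (intro sum.mono_neutral_right) (auto simp: K'_def)
    also have "\<dots> \<le> (\<Sum>k\<in>K'. (1/2) ^ k * w (\<phi> k))"
      unfolding crossing_sum_def using le by (intro sum_mono mult_left_mono) auto
    also have "\<dots> \<le> sum t {..<card K'}"
      unfolding t_def using bij dec pos crossing_family_finite[OF F'] \<phi> by (rule rearrangement_le)
    also have "\<dots> \<le> suminf t"
      using summable t_nonneg by (intro sum_le_suminf) auto
    finally show "crossing_sum \<gamma> u K P Q \<le> suminf t" .
  qed
  ultimately show ?thesis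
    unfolding t_def w_def by (rule antisym)
qed

text \<open>The choice in \<open>slab_sum\<close> is harmless: an enumeration exists, and all of
  them have the same sum.\<close>

lemma slab_sum_eq_crossing_sup:
  fixes \<gamma> :: "real \<Rightarrow> 'a::euclidean_space"
  assumes \<gamma>: "path \<gamma>" and "0 \<le> a" "b \<le> 1" "0 < \<mu>" "norm u = 1"
  shows "slab_sum \<gamma> a b u x \<mu> = crossing_sup \<gamma> a b u x \<mu>"
proof -
  have cont: "continuous_on {a..b} \<gamma>"
    using \<gamma> assms(2,3) by (auto simp: path_def intro: continuous_on_subset)
  have pos: "0 < width u (\<gamma> ` C)" if "C \<in> slab_components \<gamma> a b u x \<mu>" for C
    using that by (auto simp: slab_components_def)
  have "\<exists>N C. slab_enumeration \<gamma> a b u x \<mu> N C"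
  proof (rule sorted_enumeration_exists[of "slab_components \<gamma> a b u x \<mu>" "\<lambda>C. width u (\<gamma> ` C)"])
    fix N C assume "bij_betw C {k. enat k < N} (slab_components \<gamma> a b u x \<mu>)"
      "\<And>k. enat (Suc k) < N \<Longrightarrow> width u (\<gamma> ` C (Suc k)) \<le> width u (\<gamma> ` C k)"
    then show "\<exists>N C. slab_enumeration \<gamma> a b u x \<mu> N C"
      unfolding slab_enumeration_def by blast
  qed (use finite_wide_slab_components[OF assms] pos in simp_all)
  then obtain N C where E: "slab_enumeration \<gamma> a b u x \<mu> N C"
    by blast
  show ?thesis
    unfolding slab_sum_def
  proof (rule some_equality)
    show "\<exists>N C. slab_enumeration \<gamma> a b u x \<mu> N C \<and> crossing_sup \<gamma> a b u x \<mu>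
        = (\<Sum>k. if enat k < N then (1/2) ^ k * width u (\<gamma> ` C k) else 0)"
      by (intro exI conjI, rule E, rule slab_enumeration_sum[OF cont \<open>0 < \<mu>\<close> E, symmetric])
  next
    fix L assume "\<exists>N C. slab_enumeration \<gamma> a b u x \<mu> N C \<and>
        L = (\<Sum>k. if enat k < N then (1/2) ^ k * width u (\<gamma> ` C k) else 0)"
    then show "L = crossing_sup \<gamma> a b u x \<mu>"
      by (elim exE conjE) (simp only: slab_enumeration_sum[OF cont \<open>0 < \<mu>\<close>])
  qed
qed

section \<open>Measurability\<close>

lemma crossing_family_cong:
  assumes "\<And>k. k \<in> K \<Longrightarrow> J k = J' k" "\<And>k. k \<in> K \<Longrightarrow> P k = P' k" "\<And>k. k \<in> K \<Longrightarrow> Q k = Q' k"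
  shows "crossing_family \<gamma> a b u x \<mu> K J P Q \<longleftrightarrow> crossing_family \<gamma> a b u x \<mu> K J' P' Q'"
  unfolding crossing_family_def using assms by (intro conj_cong refl ball_cong imp_cong) simp_all

text \<open>The rational points are taken inside the interval, one near each end and on its own side
  of the midpoint, so that \<open>crossing_family_shrink\<close> applies.\<close>

lemma rational_subinterval:
  fixes f :: "real \<Rightarrow> real"
  assumes f: "continuous_on {a..b} f" and "a \<le> p" "p < q" "q \<le> b" "0 < e"
  obtains r s :: rat where "p \<le> of_rat r" "of_rat r \<le> (of_rat s :: real)" "of_rat s \<le> q"
    "\<bar>f q - f p\<bar> \<le> \<bar>f (of_rat s) - f (of_rat r)\<bar> + e"
proof -
  have near: "\<exists>\<delta>>0. \<forall>y\<in>{a..b}. \<bar>y - z\<bar> < \<delta> \<longrightarrow> \<bar>f y - f z\<bar> < e / 2" if "z \<in> {a..b}" for z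
    using f that \<open>0 < e\<close> half_gt_zero unfolding continuous_on_iff dist_real_def by blast
  obtain \<delta> where \<delta>: "\<delta> > 0" "\<And>y. y \<in> {a..b} \<Longrightarrow> \<bar>y - p\<bar> < \<delta> \<Longrightarrow> \<bar>f y - f p\<bar> < e / 2"
    using near[of p] assms by auto
  obtain \<delta>' where \<delta>': "\<delta>' > 0" "\<And>y. y \<in> {a..b} \<Longrightarrow> \<bar>y - q\<bar> < \<delta>' \<Longrightarrow> \<bar>f y - f q\<bar> < e / 2"
    using near[of q] assms by auto
  obtain r where r: "p < of_rat r" "of_rat r < min (p + \<delta>) ((p + q) / 2)"
    using of_rat_dense[of p "min (p + \<delta>) ((p + q) / 2)"] \<open>p < q\<close> \<delta>(1) by auto
  obtain s where s: "max (q - \<delta>') ((p + q) / 2) < of_rat s" "of_rat s < q"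
    using of_rat_dense[of "max (q - \<delta>') ((p + q) / 2)" q] \<open>p < q\<close> \<delta>'(1) by auto
  show ?thesis
  proof (rule that[of r s])
    have "\<bar>f (of_rat r) - f p\<bar> < e / 2"
      by (rule \<delta>(2)) (use r assms in auto)
    moreover have "\<bar>f (of_rat s) - f q\<bar> < e / 2"
      by (rule \<delta>'(2)) (use s assms in auto)
    ultimately show "\<bar>f q - f p\<bar> \<le> \<bar>f (of_rat s) - f (of_rat r)\<bar> + e"
      by linarith
  qed (use r s in auto)
qed

text \<open>Lists form a countable index type for the families with rational end points. The Boolean
  tells whether a position belongs to \<open>K\<close>. A list that codes no valid family gets 0,
  which is harmless since \<open>crossing_sup\<close> is nonnegative.\<close>

definition rational_crossing_sum ::
  "(real \<Rightarrow> 'a::euclidean_space) \<Rightarrow> real \<Rightarrow> real \<Rightarrow> 'a \<Rightarrow> real \<Rightarrow> real \<Rightarrow> (bool \<times> int \<times> rat \<times> rat) list \<Rightarrow> real" where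
  "rational_crossing_sum \<gamma> a b u x \<mu> zs =
     (let K = {k. k < length zs \<and> fst (zs ! k)}; J = (\<lambda>k. fst (snd (zs ! k)));
          P = (\<lambda>k. of_rat (fst (snd (snd (zs ! k))))); Q = (\<lambda>k. of_rat (snd (snd (snd (zs ! k)))))
      in if crossing_family \<gamma> a b u x \<mu> K J P Q then crossing_sum \<gamma> u K P Q else 0)"

lemma rational_crossing_sum_le: "rational_crossing_sum \<gamma> a b u x \<mu> zs \<le> crossing_sup \<gamma> a b u x \<mu>"
  by (simp add: rational_crossing_sum_def Let_def crossing_sup_upper crossing_sup_nonneg)

lemma bdd_above_rational_crossing_sum: "bdd_above (range (rational_crossing_sum \<gamma> a b u x \<mu>))"
  using rational_crossing_sum_le by (intro bdd_aboveI) blast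

text \<open>A nondegenerate interval shrinks to rational end points with loss at most
  \<open>e / 2\<close> of width, which the weights turn into a total loss of at most
  \<open>e\<close>; degenerate intervals contribute nothing. The supremum becomes countable, which
  makes it measurable in the parameters.\<close>

lemma crossing_sup_eq_SUP_rational:
  assumes \<gamma>: "continuous_on {a..b} \<gamma>"
  shows "crossing_sup \<gamma> a b u x \<mu> = (SUP zs. rational_crossing_sum \<gamma> a b u x \<mu> zs)"
proof (rule antisym)
  show "(SUP zs. rational_crossing_sum \<gamma> a b u x \<mu> zs) \<le> crossing_sup \<gamma> a b u x \<mu>"
    by (intro cSUP_least rational_crossing_sum_le) simp
  show "crossing_sup \<gamma> a b u x \<mu> \<le> (SUP zs. rational_crossing_sum \<gamma> a b u x \<mu> zs)"
  proof (rule crossing_sup_least, rule field_le_epsilon)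
    fix K J P Q and e :: real assume F: "crossing_family \<gamma> a b u x \<mu> K J P Q" and "0 < e"
    define K' where "K' = {k \<in> K. P k < Q k}"
    have "continuous_on {a..b} (\<lambda>t. \<gamma> t \<bullet> u)"
      using \<gamma> by (intro continuous_intros)
    note approx = rational_subinterval[OF this]
    have "\<forall>k\<in>K'. \<exists>r s. P k \<le> of_rat r \<and> of_rat r \<le> (of_rat s :: real) \<and> of_rat s \<le> Q k \<and>
        \<bar>(\<gamma> (Q k) - \<gamma> (P k)) \<bullet> u\<bar> - \<bar>(\<gamma> (of_rat s) - \<gamma> (of_rat r)) \<bullet> u\<bar> \<le> e / 2"
    proof
      fix k assume "k \<in> K'"
      then have k: "k \<in> K" "P k < Q k"
        by (auto simp: K'_def)
      obtain r s where "P k \<le> of_rat r" "of_rat r \<le> (of_rat s :: real)" "of_rat s \<le> Q k"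
          "\<bar>\<gamma> (Q k) \<bullet> u - \<gamma> (P k) \<bullet> u\<bar> \<le> \<bar>\<gamma> (of_rat s) \<bullet> u - \<gamma> (of_rat r) \<bullet> u\<bar> + e / 2"
        using approx[of "P k" "Q k" "e / 2"] crossing_familyD[OF F k(1)] k(2) \<open>0 < e\<close> by auto
      then show "\<exists>r s. P k \<le> of_rat r \<and> of_rat r \<le> (of_rat s :: real) \<and> of_rat s \<le> Q k \<and>
          \<bar>(\<gamma> (Q k) - \<gamma> (P k)) \<bullet> u\<bar> - \<bar>(\<gamma> (of_rat s) - \<gamma> (of_rat r)) \<bullet> u\<bar> \<le> e / 2"
        by (intro exI[of _ r] exI[of _ s]) (simp add: inner_diff_left)
    qed
    then obtain R S where RS: "\<And>k. k \<in> K' \<Longrightarrow> P k \<le> of_rat (R k) \<and> of_rat (R k) \<le> (of_rat (S k) :: real) \<and> of_rat (S k) \<le> Q k"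
        and close: "\<And>k. k \<in> K' \<Longrightarrow> \<bar>(\<gamma> (Q k) - \<gamma> (P k)) \<bullet> u\<bar> - \<bar>(\<gamma> (of_rat (S k)) - \<gamma> (of_rat (R k))) \<bullet> u\<bar> \<le> e / 2"
      by metis
    define P' Q' where "P' k = (of_rat (R k) :: real)" and "Q' k = (of_rat (S k) :: real)" for k
    have F': "crossing_family \<gamma> a b u x \<mu> K' J P' Q'"
      using F
    proof (rule crossing_family_shrink)
      fix k assume "k \<in> K'"
      then show "P k \<le> P' k \<and> P' k \<le> Q' k \<and> Q' k \<le> Q k \<and> a \<le> P' k \<and> Q' k \<le> b"
        using RS[of k] crossing_familyD(1,3)[OF F, of k] by (auto simp: P'_def Q'_def K'_def)
    qed (simp add: K'_def)
    obtain n where n: "K' \<subseteq> {..<n}"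
      using finite_nat_bounded[OF crossing_family_finite[OF F']] by blast
    define zs where "zs = map (\<lambda>k. (k \<in> K', J k, R k, S k)) [0..<n]"
    have zs: "length zs = n" "\<And>k. k < n \<Longrightarrow> zs ! k = (k \<in> K', J k, R k, S k)"
      by (simp_all add: zs_def)
    have "{k. k < length zs \<and> fst (zs ! k)} = K'"
      using n zs by auto
    moreover have "crossing_family \<gamma> a b u x \<mu> K' (\<lambda>k. fst (snd (zs ! k)))
        (\<lambda>k. of_rat (fst (snd (snd (zs ! k))))) (\<lambda>k. of_rat (snd (snd (snd (zs ! k)))))"
      using F' by (rule iffD1[OF crossing_family_cong, rotated -1]) (use n zs in \<open>auto simp: P'_def Q'_def\<close>)
    moreover have "crossing_sum \<gamma> u K' (\<lambda>k. of_rat (fst (snd (snd (zs ! k))))) (\<lambda>k. of_rat (snd (snd (snd (zs ! k)))))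
        = crossing_sum \<gamma> u K' P' Q'"
      unfolding crossing_sum_def using n zs by (intro sum.cong) (auto simp: P'_def Q'_def)
    ultimately have "rational_crossing_sum \<gamma> a b u x \<mu> zs = crossing_sum \<gamma> u K' P' Q'"
      by (simp add: rational_crossing_sum_def Let_def)
    then have le: "crossing_sum \<gamma> u K' P' Q' \<le> (SUP zs. rational_crossing_sum \<gamma> a b u x \<mu> zs)"
      using cSUP_upper[OF _ bdd_above_rational_crossing_sum, of zs] by (metis UNIV_I)
    have "crossing_sum \<gamma> u K P Q = crossing_sum \<gamma> u K' P Q"
      unfolding crossing_sum_def using crossing_family_finite[OF F] crossing_familyD(2)[OF F]
      by (intro sum.mono_neutral_right) (force simp: K'_def)+
    also have "\<dots> = crossing_sum \<gamma> u K' P' Q' +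
        (\<Sum>k\<in>K'. (1/2) ^ k * (\<bar>(\<gamma> (Q k) - \<gamma> (P k)) \<bullet> u\<bar> - \<bar>(\<gamma> (Q' k) - \<gamma> (P' k)) \<bullet> u\<bar>))"
      by (simp add: crossing_sum_def flip: sum.distrib distrib_left)
    also have "\<dots> \<le> (SUP zs. rational_crossing_sum \<gamma> a b u x \<mu> zs) + 2 * (e / 2)"
      using le crossing_family_finite[OF F'] close \<open>0 < e\<close>
      by (intro add_mono weighted_sum_le) (simp_all add: P'_def Q'_def)
    finally show "crossing_sum \<gamma> u K P Q \<le> (SUP zs. rational_crossing_sum \<gamma> a b u x \<mu> zs) + e"
      by simp
  qed
qed

text \<open>The condition is an intersection over uncountably many \<open>s\<close>; closedness
  survives this, whereas measurability alone would not suffice.\<close>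

lemma closed_path_in_slab:
  fixes \<gamma> :: "real \<Rightarrow> 'a::euclidean_space"
  shows "closed {\<omega> :: (real \<times> 'a) \<times> real. \<gamma> ` {p..q} \<subseteq> slab (snd (fst \<omega>)) (snd \<omega>) (fst (fst \<omega>)) j}"
proof -
  have "{\<omega> :: (real \<times> 'a) \<times> real. \<gamma> ` {p..q} \<subseteq> slab (snd (fst \<omega>)) (snd \<omega>) (fst (fst \<omega>)) j} =
      (\<Inter>s\<in>{p..q}. {\<omega>. fst (fst \<omega>) * (of_int j + snd \<omega>) \<le> \<gamma> s \<bullet> snd (fst \<omega>)} \<inter>
        {\<omega>. \<gamma> s \<bullet> snd (fst \<omega>) \<le> fst (fst \<omega>) * (of_int j + 1 + snd \<omega>)})"
    by (auto simp: slab_def image_subset_iff)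
  also have "closed \<dots>"
    by (intro closed_INT ballI closed_Int closed_Collect_le continuous_intros)
  finally show ?thesis .
qed

text \<open>For fixed rational data, membership in a family is a finite Boolean combination of
  closed conditions. The nesting of the product matches the order of integration: \<open>x\<close>
  innermost, then \<open>u\<close>, then \<open>\<mu>\<close>.\<close>

lemma borel_measurable_crossing_sup:
  fixes \<gamma> :: "real \<Rightarrow> 'a::euclidean_space"
  assumes \<gamma>: "continuous_on {a..b} \<gamma>"
  shows "(\<lambda>\<omega>. crossing_sup \<gamma> a b (snd (fst \<omega>)) (snd \<omega>) (fst (fst \<omega>)))
    \<in> borel_measurable ((lborel \<Otimes>\<^sub>M sphere_measure) \<Otimes>\<^sub>M lborel)"
proof -
  have sets: "sets ((lborel \<Otimes>\<^sub>M sphere_measure) \<Otimes>\<^sub>M lborel)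
      = sets (borel :: ((real \<times> 'a) \<times> real) measure)"
    unfolding borel_prod[symmetric] by (intro sets_pair_measure_cong) simp_all
  have [measurable]: "Measurable.pred borel
      (\<lambda>\<omega> :: (real \<times> 'a) \<times> real. \<gamma> ` {p..q} \<subseteq> slab (snd (fst \<omega>)) (snd \<omega>) (fst (fst \<omega>)) j)" for p q j
    using borel_closed[OF closed_path_in_slab[of \<gamma> p q j]] by (simp add: pred_def)
  have [measurable]: "(\<lambda>\<omega> :: (real \<times> 'a) \<times> real. crossing_sum \<gamma> (snd (fst \<omega>)) K P Q) \<in> borel_measurable borel" for K P Q
    unfolding crossing_sum_def by (intro borel_measurable_continuous_onI continuous_intros)
  have [measurable]: "Measurable.pred borel
      (\<lambda>\<omega> :: (real \<times> 'a) \<times> real. crossing_family \<gamma> a b (snd (fst \<omega>)) (snd \<omega>) (fst (fst \<omega>)) K J P Q)" for K J P Q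
    unfolding crossing_family_def by measurable
  have "(\<lambda>\<omega> :: (real \<times> 'a) \<times> real. rational_crossing_sum \<gamma> a b (snd (fst \<omega>)) (snd \<omega>) (fst (fst \<omega>)) zs)
      \<in> borel_measurable borel" for zs
    unfolding rational_crossing_sum_def Let_def by measurable
  then have "(\<lambda>\<omega> :: (real \<times> 'a) \<times> real. SUP zs. rational_crossing_sum \<gamma> a b (snd (fst \<omega>)) (snd \<omega>) (fst (fst \<omega>)) zs)
      \<in> borel_measurable borel"
    by (intro borel_measurable_cSUP bdd_above_rational_crossing_sum) simp_all
  then show ?thesis
    unfolding measurable_cong_sets[OF sets refl] by (simp only: crossing_sup_eq_SUP_rational[OF \<gamma>])
qed

section \<open>Caps of the sphere and comparison of set integrals\<close>

text \<open>The ball of radius \<open>1/4\<close> around half the unit vector along \<open>v\<close>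
  lies in the unit ball and projects radially into the cap, since dividing by a norm below 1 does
  not decrease a nonnegative inner product. Its volume relative to the unit ball is the stated
  bound.\<close>

lemma measure_sphere_cap_ge:
  fixes v :: "'a::euclidean_space"
  assumes "v \<noteq> 0"
  shows "(1/4) ^ DIM('a) \<le> measure sphere_measure {u \<in> sphere (0::'a) 1. norm v / 4 \<le> \<bar>v \<bullet> u\<bar>}"
proof -
  define A where "A = {u \<in> sphere (0::'a) 1. norm v / 4 \<le> \<bar>v \<bullet> u\<bar>}"
  have [measurable]: "A \<in> sets borel"
    unfolding A_def by measurable
  have vim [measurable]: "sgn -` A \<in> sets borel"
    using measurable_sets[OF sgn_borel_measurable \<open>A \<in> sets borel\<close>] by simp
  define c where "c = sgn v /\<^sub>R 2"
  have "ball c (1/4) \<subseteq> ball 0 1 \<inter> sgn -` A"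
  proof
    fix z assume "z \<in> ball c (1/4)"
    then have dist: "norm (z - c) < 1/4"
      by (simp add: dist_norm norm_minus_commute)
    have "norm c = 1/2"
      using assms by (simp add: c_def norm_sgn)
    then have "norm z < 1"
      using dist norm_triangle_ineq[of "z - c" c] by simp
    have "\<bar>(z - c) \<bullet> sgn v\<bar> \<le> 1/4"
      using Cauchy_Schwarz_ineq2[of "z - c" "sgn v"] dist assms by (simp add: norm_sgn)
    moreover have "c \<bullet> sgn v = 1/2"
      using assms by (simp add: c_def norm_sgn flip: power2_norm_eq_inner)
    ultimately have ge: "1/4 \<le> z \<bullet> sgn v"
      unfolding inner_diff_left by linarith
    then have "z \<noteq> 0"
      by auto
    have "norm v / 4 \<le> norm v * (z \<bullet> sgn v)"
      using ge mult_left_mono[of "1/4" "z \<bullet> sgn v" "norm v"] by simp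
    also have "\<dots> = v \<bullet> z"
      using assms by (simp add: sgn_div_norm inner_commute)
    also have "\<dots> \<le> (v \<bullet> z) / norm z"
    proof -
      have "0 \<le> v \<bullet> z"
        using calculation norm_ge_zero[of v] by linarith
      then show ?thesis
        using mult_left_le[of "norm z" "v \<bullet> z"] \<open>norm z < 1\<close> \<open>z \<noteq> 0\<close> by (simp add: divide_simps)
    qed
    also have "\<dots> = v \<bullet> sgn z"
      by (simp add: sgn_div_norm divide_inverse mult.commute)
    finally have "norm v / 4 \<le> v \<bullet> sgn z" .
    then show "z \<in> ball 0 1 \<inter> sgn -` A"
      using \<open>norm z < 1\<close> \<open>z \<noteq> 0\<close> by (auto simp: A_def norm_sgn)
  qed
  then have le: "measure lborel (ball c (1/4)) \<le> measure lborel (ball 0 1 \<inter> sgn -` A)"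
    using emeasure_lborel_ball_finite[of "0::'a" 1]
    by (intro measure_mono_fmeasurable fmeasurable_Int_fmeasurable) (auto simp: fmeasurable_def)
  have vol: "0 < unit_ball_vol (real DIM('a))"
    by simp
  have ball: "emeasure lborel (ball (0::'a) 1) \<noteq> 0" "emeasure lborel (ball (0::'a) 1) \<noteq> \<infinity>"
    using vol emeasure_lborel_ball_finite[of "0::'a" 1] by (auto simp: emeasure_ball simp del: unit_ball_vol_pos)
  have "measure sphere_measure A = measure (uniform_measure lborel (ball 0 1)) (sgn -` A)"
    unfolding sphere_measure_def by (subst measure_distr) auto
  also have "\<dots> = measure lborel (ball 0 1 \<inter> sgn -` A) / measure lborel (ball (0::'a) 1)"
    using ball by (intro measure_uniform_measure) auto
  also have "\<dots> \<ge> measure lborel (ball c (1/4)) / measure lborel (ball (0::'a) 1)"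
    using le by (intro divide_right_mono) auto
  also have "measure lborel (ball c (1/4)) / measure lborel (ball (0::'a) 1) = (1/4) ^ DIM('a)"
    using less_imp_neq[OF vol] by (simp add: content_ball del: unit_ball_vol_pos)
  finally show ?thesis
    by (simp add: A_def)
qed

text \<open>Integrates \<open>f + d * indicator B \<le> g\<close> over \<open>A\<close>. The sign of
  \<open>d\<close> is free: a negative \<open>d\<close> bounds how far the integral of
  \<open>f\<close> can exceed that of \<open>g\<close>, and an empty \<open>B\<close> gives
  monotonicity.\<close>

lemma set_integral_add_le:
  fixes f g :: "'b \<Rightarrow> real"
  assumes [measurable]: "A \<in> sets M" "B \<in> sets M" "f \<in> borel_measurable M" "g \<in> borel_measurable M"
    and "emeasure M A < \<infinity>" "B \<subseteq> A"
    and bnd: "\<And>x. x \<in> A \<Longrightarrow> \<bar>f x\<bar> \<le> c" "\<And>x. x \<in> A \<Longrightarrow> \<bar>g x\<bar> \<le> c"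
    and le: "\<And>x. x \<in> A - B \<Longrightarrow> f x \<le> g x" "\<And>x. x \<in> B \<Longrightarrow> f x + d \<le> g x"
  shows "(LINT x:A|M. f x) + d * measure M B \<le> (LINT x:A|M. g x)"
proof -
  have int: "integrable M (\<lambda>x. indicator A x *\<^sub>R f x)" "integrable M (\<lambda>x. indicator A x *\<^sub>R g x)"
    using assms by (intro integrableI_bounded_set_indicator[where B = c]; simp)+
  have "emeasure M B < \<infinity>"
    using assms emeasure_mono[of B A M] by (auto intro: le_less_trans)
  then have intB: "integrable M (\<lambda>x. d * indicator B x)"
    by simp
  have "(LINT x:A|M. f x) + d * measure M B = (LINT x|M. indicator A x *\<^sub>R f x + d * indicator B x)"
    using int intB by (subst Bochner_Integration.integral_add) (auto simp: set_lebesgue_integral_def)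
  also have "\<dots> \<le> (LINT x|M. indicator A x *\<^sub>R g x)"
  proof (rule integral_mono)
    fix x
    show "indicator A x *\<^sub>R f x + d * indicator B x \<le> indicator A x *\<^sub>R g x"
      using le(1)[of x] le(2)[of x] \<open>B \<subseteq> A\<close> by (auto simp: indicator_def)
  qed (use int intB in auto)
  finally show ?thesis
    by (simp add: set_lebesgue_integral_def)
qed

lemma set_integral_unit_bounds:
  fixes f :: "'b \<Rightarrow> real"
  assumes [measurable]: "A \<in> sets M" "f \<in> borel_measurable M" and A: "emeasure M A = 1"
    and f: "\<And>x. x \<in> A \<Longrightarrow> 0 \<le> f x \<and> f x \<le> c"
  shows "0 \<le> (LINT x:A|M. f x)" "(LINT x:A|M. f x) \<le> c"
proof -
  have "measure M A = 1"
    using A by (simp add: measure_def)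
  moreover have "\<bar>f x\<bar> \<le> \<bar>c\<bar>" if "x \<in> A" for x
    using f[OF that] by auto
  \<comment> \<open>The zero function as \<open>g\<close> and the increment \<open>- c\<close> on
    all of \<open>A\<close> give the upper bound.\<close>
  ultimately show "(LINT x:A|M. f x) \<le> c"
    using set_integral_add_le[of A M A f "\<lambda>_. 0" "\<bar>c\<bar>" "- c"] A f by (simp add: set_lebesgue_integral_def)
  show "0 \<le> (LINT x:A|M. f x)"
    unfolding set_lebesgue_integral_def using f by (intro integral_nonneg_AE) (auto simp: indicator_def)
qed

section \<open>Growth of the length\<close>

definition inner_len :: "(real \<Rightarrow> 'a::euclidean_space) \<Rightarrow> real \<Rightarrow> real \<Rightarrow> 'a \<Rightarrow> real" where
  "inner_len \<gamma> b \<mu> u = (LINT x:{0..1}|lborel. crossing_sup \<gamma> 0 b u x \<mu>)"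

definition middle_len :: "(real \<Rightarrow> 'a::euclidean_space) \<Rightarrow> real \<Rightarrow> real \<Rightarrow> real" where
  "middle_len \<gamma> b \<mu> = (LINT u:sphere 0 1|sphere_measure. inner_len \<gamma> b \<mu> u)"

text \<open>\<open>slab_sum\<close> and \<open>crossing_sup\<close> agree for positive
  \<open>\<mu>\<close> and unit \<open>u\<close>, and the set integrals see only such
  parameters.\<close>

lemma len_eq:
  fixes \<gamma> :: "real \<Rightarrow> 'a::euclidean_space"
  assumes \<gamma>: "path \<gamma>" and "b \<le> 1"
  shows "len \<gamma> 0 b = (LINT \<mu>:{0<..1}|lborel. middle_len \<gamma> b \<mu>)"
proof -
  have "(LINT u:sphere 0 1|sphere_measure. LINT x:{0..1}|lborel. slab_sum \<gamma> 0 b u x \<mu>) = middle_len \<gamma> b \<mu>"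
    if "\<mu> \<in> {0<..1}" for \<mu>
    unfolding middle_len_def inner_len_def
  proof (rule set_lebesgue_integral_cong)
    show "\<forall>u. u \<in> sphere 0 1 \<longrightarrow> (LINT x:{0..1}|lborel. slab_sum \<gamma> 0 b u x \<mu>)
        = (LINT x:{0..1}|lborel. crossing_sup \<gamma> 0 b u x \<mu>)"
      using slab_sum_eq_crossing_sup[OF \<gamma> order_refl \<open>b \<le> 1\<close>] that by simp
  qed simp
  then show ?thesis
    unfolding len_def by (intro set_lebesgue_integral_cong) auto
qed

text \<open>Joint measurability passes to sections, and integrating out the last variable over a
  sigma-finite measure preserves it; this is applied first to \<open>x\<close> and then to
  \<open>u\<close>.\<close>

lemma path_measurability:
  fixes \<gamma> :: "real \<Rightarrow> 'a::euclidean_space"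
  assumes \<gamma>: "path \<gamma>" and "b \<le> 1"
  shows borel_measurable_crossing_sup_shift: "(\<lambda>x. crossing_sup \<gamma> 0 b u x \<mu>) \<in> borel_measurable lborel"
    and borel_measurable_inner_len: "inner_len \<gamma> b \<mu> \<in> borel_measurable sphere_measure"
    and borel_measurable_middle_len: "middle_len \<gamma> b \<in> borel_measurable lborel"
proof -
  interpret prob_space "sphere_measure :: 'a measure"
    by (rule prob_space_sphere_measure)
  have [measurable]: "sphere (0::'a) 1 \<in> sets borel"
    by (simp add: borel_closed)
  have "continuous_on {0..b} \<gamma>"
    using \<gamma> \<open>b \<le> 1\<close> by (auto simp: path_def intro: continuous_on_subset)
  note joint [measurable] = borel_measurable_crossing_sup[OF this]
  have "(\<lambda>x. ((\<mu>, u), x)) \<in> lborel \<rightarrow>\<^sub>M (lborel \<Otimes>\<^sub>M sphere_measure) \<Otimes>\<^sub>M lborel"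
    by measurable
  from measurable_compose[OF this joint]
  show "(\<lambda>x. crossing_sup \<gamma> 0 b u x \<mu>) \<in> borel_measurable lborel"
    by simp
  have inner [measurable]: "(\<lambda>p. inner_len \<gamma> b (fst p) (snd p)) \<in> borel_measurable (lborel \<Otimes>\<^sub>M sphere_measure)"
    unfolding inner_len_def set_lebesgue_integral_def
  proof (rule lborel.borel_measurable_lebesgue_integral)
    show "(\<lambda>(p, x). indicator {0..1} x *\<^sub>R crossing_sup \<gamma> 0 b (snd p) x (fst p))
        \<in> borel_measurable ((lborel \<Otimes>\<^sub>M sphere_measure) \<Otimes>\<^sub>M lborel)"
      unfolding case_prod_beta by measurable
  qed
  have "(\<lambda>u. (\<mu>, u)) \<in> sphere_measure \<rightarrow>\<^sub>M lborel \<Otimes>\<^sub>M sphere_measure"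
    by measurable
  from measurable_compose[OF this inner]
  show "inner_len \<gamma> b \<mu> \<in> borel_measurable sphere_measure"
    by simp
  show "middle_len \<gamma> b \<in> borel_measurable lborel"
    unfolding middle_len_def[abs_def] set_lebesgue_integral_def
  proof (rule borel_measurable_lebesgue_integral)
    show "(\<lambda>(\<mu>, u). indicator (sphere 0 1) u *\<^sub>R inner_len \<gamma> b \<mu> u)
        \<in> borel_measurable (lborel \<Otimes>\<^sub>M sphere_measure)"
      unfolding case_prod_beta by measurable
  qed
qed

section \<open>Bounds, monotonicity and continuity of the length\<close>

context
  fixes \<gamma> :: "real \<Rightarrow> 'a::euclidean_space"
  assumes \<gamma>: "path \<gamma>"
begin

lemma inner_len_bounds:
  assumes "b \<le> 1" "\<mu> \<in> {0<..1}"
  shows "0 \<le> inner_len \<gamma> b \<mu> u" "inner_len \<gamma> b \<mu> u \<le> 2"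
proof -
  have bnd: "0 \<le> crossing_sup \<gamma> 0 b u x \<mu> \<and> crossing_sup \<gamma> 0 b u x \<mu> \<le> 2" for x
    using crossing_sup_nonneg[of \<gamma> 0 b u x \<mu>] crossing_sup_le[of \<gamma> 0 b u x \<mu>] assms(2) by auto
  have A: "{0..1::real} \<in> sets lborel" "emeasure lborel {0..1::real} = 1"
    by simp_all
  note bounds = set_integral_unit_bounds[OF A(1) borel_measurable_crossing_sup_shift[OF \<gamma> \<open>b \<le> 1\<close>] A(2) bnd]
  show "0 \<le> inner_len \<gamma> b \<mu> u" "inner_len \<gamma> b \<mu> u \<le> 2"
    unfolding inner_len_def by (fact bounds)+
qed

lemma middle_len_bounds:
  assumes "b \<le> 1" "\<mu> \<in> {0<..1}"
  shows "0 \<le> middle_len \<gamma> b \<mu>" "middle_len \<gamma> b \<mu> \<le> 2"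
proof -
  have A: "sphere (0::'a) 1 \<in> sets sphere_measure"
    by (simp add: borel_closed)
  have bnd: "0 \<le> inner_len \<gamma> b \<mu> u \<and> inner_len \<gamma> b \<mu> u \<le> 2" for u
    using inner_len_bounds[OF assms] by blast
  note bounds = set_integral_unit_bounds[OF A borel_measurable_inner_len[OF \<gamma> \<open>b \<le> 1\<close>] sphere_measure_sphere bnd]
  show "0 \<le> middle_len \<gamma> b \<mu>" "middle_len \<gamma> b \<mu> \<le> 2"
    unfolding middle_len_def by (fact bounds)+
qed

text \<open>Since \<open>crossing_sup\<close> is at most \<open>2 * \<mu>\<close> and each
  integration runs over a set of measure 1, the bound 2 is the same for all paths.\<close>

lemma len_bounds:
  assumes "b \<le> 1"
  shows "0 \<le> len \<gamma> 0 b" "len \<gamma> 0 b \<le> 2"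
proof -
  have A: "{0<..1::real} \<in> sets lborel" "emeasure lborel {0<..1::real} = 1"
    by simp_all
  have bnd: "0 \<le> middle_len \<gamma> b \<mu> \<and> middle_len \<gamma> b \<mu> \<le> 2" if "\<mu> \<in> {0<..1}" for \<mu>
    using middle_len_bounds[OF assms that] by blast
  note bounds = set_integral_unit_bounds[OF A(1) borel_measurable_middle_len[OF \<gamma> assms] A(2) bnd]
  show "0 \<le> len \<gamma> 0 b" "len \<gamma> 0 b \<le> 2"
    unfolding len_eq[OF \<gamma> assms] by (rule bounds, assumption)+
qed

text \<open>The increment \<open>d\<close> is available for \<open>\<mu>\<close> in
  \<open>B\<close>, \<open>u\<close> in \<open>U\<close> and all \<open>x\<close>; integrating three
  times multiplies it by the two measures. Empty sets give monotonicity, a negative \<open>d\<close>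
  bounds the growth of the length from above, and a positive one bounds it from below.\<close>

lemma len_add_le:
  assumes bc: "b \<le> 1" "c \<le> 1" and B: "B \<in> sets borel" "B \<subseteq> {0<..1}"
    and U: "\<And>\<mu>. \<mu> \<in> B \<Longrightarrow> U \<in> sets borel" "U \<subseteq> sphere 0 1"
    and le: "\<And>u x \<mu>. u \<in> sphere 0 1 \<Longrightarrow> \<mu> \<in> {0<..1} \<Longrightarrow> \<mu> \<notin> B \<or> u \<notin> U
      \<Longrightarrow> crossing_sup \<gamma> 0 b u x \<mu> \<le> crossing_sup \<gamma> 0 c u x \<mu>"
    and add_le: "\<And>u x \<mu>. u \<in> U \<Longrightarrow> \<mu> \<in> B \<Longrightarrow> crossing_sup \<gamma> 0 b u x \<mu> + d \<le> crossing_sup \<gamma> 0 c u x \<mu>"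
  shows "len \<gamma> 0 b + d * measure sphere_measure U * measure lborel B \<le> len \<gamma> 0 c"
proof -
  have bound: "\<bar>crossing_sup \<gamma> 0 t u x \<mu>\<bar> \<le> 2" if "\<mu> \<in> {0<..1}" for t u x \<mu>
    using crossing_sup_nonneg[of \<gamma> 0 t u x \<mu>] crossing_sup_le[of \<gamma> 0 t u x \<mu>] that by auto
  have inner: "inner_len \<gamma> b \<mu> u + e \<le> inner_len \<gamma> c \<mu> u"
    if "\<mu> \<in> {0<..1}" and add: "\<And>x. crossing_sup \<gamma> 0 b u x \<mu> + e \<le> crossing_sup \<gamma> 0 c u x \<mu>" for \<mu> u e
    using set_integral_add_le[of "{0..1}" lborel "{0..1}" "\<lambda>x. crossing_sup \<gamma> 0 b u x \<mu>"
        "\<lambda>x. crossing_sup \<gamma> 0 c u x \<mu>" 2 e] bound[OF that(1)] add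
      borel_measurable_crossing_sup_shift[OF \<gamma> bc(1)] borel_measurable_crossing_sup_shift[OF \<gamma> bc(2)]
    by (simp add: inner_len_def)
  have inner_bnd: "\<bar>inner_len \<gamma> t \<mu> u\<bar> \<le> 2" if "t \<le> 1" "\<mu> \<in> {0<..1}" for t u \<mu>
    using inner_len_bounds[OF that, of u] by simp
  have middle_bnd: "\<bar>middle_len \<gamma> t \<mu>\<bar> \<le> 2" if "t \<le> 1" "\<mu> \<in> {0<..1}" for t \<mu>
    using middle_len_bounds[OF that] by simp
  have sphere: "emeasure sphere_measure (sphere (0::'a) 1) < \<infinity>"
    by (simp add: sphere_measure_sphere)
  have middle: "middle_len \<gamma> b \<mu> \<le> middle_len \<gamma> c \<mu>" if \<mu>: "\<mu> \<in> {0<..1} - B" for \<mu>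
  proof -
    have "(LINT u:sphere 0 1|sphere_measure. inner_len \<gamma> b \<mu> u) + 0 * measure sphere_measure ({}::'a set)
        \<le> (LINT u:sphere 0 1|sphere_measure. inner_len \<gamma> c \<mu> u)"
    proof (rule set_integral_add_le[where c = 2])
      show "inner_len \<gamma> b \<mu> u \<le> inner_len \<gamma> c \<mu> u" if "u \<in> sphere 0 1 - {}" for u
        using inner[of \<mu> u 0] le[of u \<mu>] that \<mu> by simp
      show "\<bar>inner_len \<gamma> b \<mu> u\<bar> \<le> 2" "\<bar>inner_len \<gamma> c \<mu> u\<bar> \<le> 2" for u
        using inner_bnd \<mu> bc by auto
    qed (use sphere borel_measurable_inner_len[OF \<gamma>] bc in \<open>auto simp: borel_closed\<close>)
    then show ?thesis
      by (simp add: middle_len_def)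
  qed
  have middle_add: "middle_len \<gamma> b \<mu> + d * measure sphere_measure U \<le> middle_len \<gamma> c \<mu>" if \<mu>: "\<mu> \<in> B" for \<mu>
    unfolding middle_len_def
  proof (rule set_integral_add_le[where c = 2])
    have \<mu>': "\<mu> \<in> {0<..1}"
      using B \<mu> by auto
    show "inner_len \<gamma> b \<mu> u \<le> inner_len \<gamma> c \<mu> u" if "u \<in> sphere 0 1 - U" for u
      using inner[OF \<mu>', of u 0] le[OF _ \<mu>'] that by simp
    show "inner_len \<gamma> b \<mu> u + d \<le> inner_len \<gamma> c \<mu> u" if "u \<in> U" for u
      using inner[OF \<mu>', of u d] add_le[OF that \<mu>] by simp
    show "\<bar>inner_len \<gamma> b \<mu> u\<bar> \<le> 2" "\<bar>inner_len \<gamma> c \<mu> u\<bar> \<le> 2" for u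
      using inner_bnd \<mu>' bc by auto
  qed (use U \<mu> sphere borel_measurable_inner_len[OF \<gamma>] bc in \<open>auto simp: borel_closed\<close>)
  show ?thesis
    unfolding len_eq[OF \<gamma> bc(1)] len_eq[OF \<gamma> bc(2)]
    using middle middle_add middle_bnd B bc borel_measurable_middle_len[OF \<gamma>]
    by (intro set_integral_add_le[where c = 2]) auto
qed

lemma len_mono:
  assumes "b \<le> c" "c \<le> 1"
  shows "len \<gamma> 0 b \<le> len \<gamma> 0 c"
proof -
  have "len \<gamma> 0 b + 0 * measure sphere_measure ({}::'a set) * measure lborel ({}::real set) \<le> len \<gamma> 0 c"
    by (rule len_add_le) (use assms in \<open>auto intro: crossing_sup_mono\<close>)
  then show ?thesis
    by simp
qed

text \<open>The end points exchange roles in \<open>len_add_le\<close>, with increment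
  \<open>- (4 * e)\<close> on the whole range of parameters, whose measures are 1.\<close>

lemma len_osc:
  assumes "0 \<le> b" "b \<le> c" "c \<le> 1" and "0 \<le> e" and osc: "\<And>s. s \<in> {b..c} \<Longrightarrow> dist (\<gamma> s) (\<gamma> b) \<le> e"
  shows "len \<gamma> 0 c \<le> len \<gamma> 0 b + 4 * e"
proof -
  have le: "crossing_sup \<gamma> 0 c u x \<mu> + - (4 * e) \<le> crossing_sup \<gamma> 0 b u x \<mu>" if u: "u \<in> sphere 0 1" for u x \<mu>
  proof -
    have "\<bar>(\<gamma> s - \<gamma> b) \<bullet> u\<bar> \<le> e" if "s \<in> {b..c}" for s
      using Cauchy_Schwarz_ineq2[of "\<gamma> s - \<gamma> b" u] osc[OF that] u by (simp add: dist_norm)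
    then show ?thesis
      using crossing_sup_le_add[of 0 b c e \<gamma> u x \<mu>] assms by simp
  qed
  have "len \<gamma> 0 c + - (4 * e) * measure sphere_measure (sphere (0::'a) 1) * measure lborel {0<..1::real} \<le> len \<gamma> 0 b"
    by (rule len_add_le) (use assms le in auto)
  then show ?thesis
    by (simp add: measure_def[of sphere_measure] sphere_measure_sphere)
qed

lemma continuous_on_len: "continuous_on {0..1} (len \<gamma> 0)"
  unfolding continuous_on_iff
proof (intro ballI allI impI)
  fix b e :: real assume "b \<in> {0..1}" "0 < e"
  have "uniformly_continuous_on {0..1} \<gamma>"
    using \<gamma> by (intro compact_uniformly_continuous) (auto simp: path_def)
  \<comment> \<open>A fifth of \<open>e\<close>, because \<open>len_osc\<close> multiplies the
    oscillation by 4.\<close>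
  then obtain \<delta> where \<delta>: "\<delta> > 0"
      "\<And>s t. s \<in> {0..1} \<Longrightarrow> t \<in> {0..1} \<Longrightarrow> dist t s < \<delta> \<Longrightarrow> dist (\<gamma> t) (\<gamma> s) < e / 5"
    using \<open>0 < e\<close> unfolding uniformly_continuous_on_def by (metis zero_less_divide_iff zero_less_numeral)
  have "\<bar>len \<gamma> 0 t - len \<gamma> 0 s\<bar> < e" if st: "s \<in> {0..1}" "t \<in> {0..1}" "s \<le> t" "t - s < \<delta>" for s t
  proof -
    have "len \<gamma> 0 t \<le> len \<gamma> 0 s + 4 * (e / 5)"
    proof (rule len_osc)
      show "dist (\<gamma> r) (\<gamma> s) \<le> e / 5" if "r \<in> {s..t}" for r
        using \<delta>(2)[of s r] st that by (auto simp: dist_real_def)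
    qed (use st \<open>0 < e\<close> in auto)
    then show ?thesis
      using len_mono[of s t] st \<open>0 < e\<close> by auto
  qed
  then have "dist (len \<gamma> 0 c) (len \<gamma> 0 b) < e" if "c \<in> {0..1}" "dist c b < \<delta>" for c
    using that \<open>b \<in> {0..1}\<close> by (cases "b \<le> c") (force simp: dist_real_def abs_minus_commute)+
  then show "\<exists>\<delta>>0. \<forall>c\<in>{0..1}. dist c b < \<delta> \<longrightarrow> dist (len \<gamma> 0 c) (len \<gamma> 0 b) < e"
    using \<delta>(1) by blast
qed

section \<open>Lower bound for the increment, and standard parameterizations\<close>

lemma len_0: "len \<gamma> 0 0 = 0"
proof -
  have "crossing_sup \<gamma> 0 0 u x \<mu> \<le> 0" for u x \<mu>
  proof (rule crossing_sup_least)
    fix K J P Q assume F: "crossing_family \<gamma> 0 0 u x \<mu> K J P Q"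
    have "P k = Q k" if "k \<in> K" for k
      using crossing_familyD[OF F that] by linarith
    then show "crossing_sum \<gamma> u K P Q \<le> 0"
      by (simp add: crossing_sum_def)
  qed
  then have "crossing_sup \<gamma> 0 0 u x \<mu> = 0" for u x \<mu>
    using crossing_sup_nonneg by (intro antisym)
  then show ?thesis
    by (simp add: len_eq[OF \<gamma>] middle_len_def inner_len_def)
qed

text \<open>For \<open>u\<close> in the cap the displacement has component at least
  \<open>\<epsilon> / 4\<close>, hence at least \<open>2 * \<mu>\<close> when
  \<open>\<mu> \<le> \<epsilon> / 8\<close>. The bound \<open>\<mu> \<ge> \<epsilon> / 16\<close>
  makes \<open>\<epsilon> / 32\<close> at most \<open>\<mu> / 2\<close>, as the count of wide
  crossings needs, and \<open>\<epsilon> \<le> 1\<close> keeps \<open>\<mu>\<close> in the range of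
  integration. The factors are the gain in the weighted sum, the cap and the range of
  \<open>\<mu>\<close>.\<close>

lemma len_increment:
  assumes few: "few_oscillations \<gamma> (\<epsilon> / 32) N" and "0 < \<epsilon>" "\<epsilon> \<le> 1"
    and bc: "0 \<le> b" "b \<le> c" "c \<le> 1" and far: "\<epsilon> \<le> dist (\<gamma> c) (\<gamma> b)"
  shows "len \<gamma> 0 b + (1/2) ^ (2 * N) * (\<epsilon> / 32) * (1/4) ^ DIM('a) * (\<epsilon> / 16) \<le> len \<gamma> 0 c"
proof -
  define v where "v = \<gamma> c - \<gamma> b"
  define U where "U = {u \<in> sphere (0::'a) 1. norm v / 4 \<le> \<bar>v \<bullet> u\<bar>}"
  have v: "\<epsilon> \<le> norm v" "v \<noteq> 0"
    using far \<open>0 < \<epsilon>\<close> by (auto simp: v_def dist_norm)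
  have "measure lborel {\<epsilon> / 16..\<epsilon> / 8} = \<epsilon> / 16"
    using \<open>0 < \<epsilon>\<close> by simp
  moreover have "len \<gamma> 0 b + (1/2) ^ (2 * N) * (\<epsilon> / 32) * measure sphere_measure U * measure lborel {\<epsilon> / 16..\<epsilon> / 8} \<le> len \<gamma> 0 c"
  proof (rule len_add_le)
    show "U \<in> sets borel"
      unfolding U_def by measurable
    fix u x \<mu> assume u: "u \<in> U" and \<mu>: "\<mu> \<in> {\<epsilon> / 16..\<epsilon> / 8}"
    have "(1/2) ^ (2 * N) * (\<epsilon> / 32) \<le> (1/2) ^ (2 * N) * (\<mu> / 2)"
      using \<mu> by (intro mult_left_mono) auto
    moreover have "crossing_sup \<gamma> 0 b u x \<mu> + (1/2) ^ (2 * N) * (\<mu> / 2) \<le> crossing_sup \<gamma> 0 c u x \<mu>"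
      using few bc \<mu> u v \<open>0 < \<epsilon>\<close>
      by (intro crossing_sup_increment[OF \<gamma>]) (auto simp: U_def v_def)
    ultimately show "crossing_sup \<gamma> 0 b u x \<mu> + (1/2) ^ (2 * N) * (\<epsilon> / 32) \<le> crossing_sup \<gamma> 0 c u x \<mu>"
      by linarith
  qed (use assms crossing_sup_mono[OF \<open>b \<le> c\<close>] in \<open>auto simp: U_def\<close>)
  ultimately have "len \<gamma> 0 b + (1/2) ^ (2 * N) * (\<epsilon> / 32) * measure sphere_measure U * (\<epsilon> / 16) \<le> len \<gamma> 0 c"
    by (simp only:)
  moreover have "(1/2) ^ (2 * N) * (\<epsilon> / 32) * (1/4) ^ DIM('a) * (\<epsilon> / 16)
      \<le> (1/2) ^ (2 * N) * (\<epsilon> / 32) * measure sphere_measure U * (\<epsilon> / 16)"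
    using measure_sphere_cap_ge[OF v(2)] \<open>0 < \<epsilon>\<close>
    by (intro mult_right_mono mult_left_mono) (auto simp: U_def)
  ultimately show ?thesis
    by linarith
qed

text \<open>The length is continuous and runs from 0 to its total, so the intermediate value theorem
  supplies a \<open>t\<close> for the choice in \<open>standard_param\<close>. Later arguments hold
  for whichever \<open>t\<close> is chosen.\<close>

lemma standard_param_cases:
  assumes "\<not> \<gamma> constant_on {0..1}" "s \<in> {0..1}"
  obtains t where "t \<in> {0..1}" "len \<gamma> 0 t = s * len \<gamma> 0 1" "standard_param \<gamma> s = \<gamma> t"
proof -
  have "s * len \<gamma> 0 1 \<le> len \<gamma> 0 1"
    using mult_left_le_one_le[of "len \<gamma> 0 1" s] len_bounds(1)[of 1] assms(2) by simp
  then have "\<exists>t\<in>{0..1}. len \<gamma> 0 t = s * len \<gamma> 0 1"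
    using IVT'[OF _ _ _ continuous_on_len, of "s * len \<gamma> 0 1"] len_0 len_bounds(1)[of 1] assms(2) by auto
  then have ex: "\<exists>t. t \<in> {0..1} \<and> len \<gamma> 0 t = s * len \<gamma> 0 1"
    by blast
  define t where "t = (SOME t. t \<in> {0..1} \<and> len \<gamma> 0 t = s * len \<gamma> 0 1)"
  have "t \<in> {0..1} \<and> len \<gamma> 0 t = s * len \<gamma> 0 1"
    unfolding t_def by (rule someI_ex[OF ex])
  moreover have "standard_param \<gamma> s = \<gamma> t"
    using assms(1) by (simp add: standard_param_def t_def)
  ultimately show ?thesis
    using that by blast
qed

end

lemma bounded_oscillation_imp_equicontinuous:
  fixes \<F> :: "(real \<Rightarrow> 'a::euclidean_space) set set"
  assumes \<F>: "\<F> \<subseteq> path_classes" and bnd: "uniformly_bounded_oscillation \<F>"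
  shows "equicontinuous_on {0..1} {standard_param \<gamma> |\<gamma>. \<gamma> \<in> \<Union>\<F>}"
  unfolding equicontinuous_on_compact_iff_uniform[OF compact_Icc]
proof (intro allI impI)
  fix \<epsilon> :: real assume "0 < \<epsilon>"
  \<comment> \<open>\<open>len_increment\<close> is stated for thresholds up to 1.\<close>
  define e where "e = min \<epsilon> 1"
  have e: "0 < e" "e \<le> 1" "e \<le> \<epsilon>"
    using \<open>0 < \<epsilon>\<close> by (auto simp: e_def)
  obtain N where few: "\<And>\<gamma>. \<gamma> \<in> \<Union>\<F> \<Longrightarrow> few_oscillations \<gamma> (e / 32) N"
    using bnd e(1) unfolding uniformly_bounded_oscillation_iff
    by (metis zero_less_divide_iff zero_less_numeral)
  define d where "d = (1/2) ^ (2 * N) * (e / 32) * (1/4) ^ DIM('a) * (e / 16)"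
  have "0 < d"
    using e by (simp add: d_def)
  \<comment> \<open>As the total length is at most 2, a parameter distance below
    \<open>d / 2\<close> means a length difference below \<open>d\<close>; the contrapositive of
    \<open>len_increment\<close> then puts the points less than \<open>e\<close> apart. Here
    \<open>d\<close> depends only on \<open>e\<close>, \<open>N\<close> and the dimension, not on
    the path.\<close>
  have close: "dist (standard_param \<gamma> y) (standard_param \<gamma> x) < \<epsilon>"
    if \<gamma>\<F>: "\<gamma> \<in> \<Union>\<F>" and xy: "x \<in> {0..1}" "y \<in> {0..1}" "dist y x < d / 2" for \<gamma> x y
  proof (cases "\<gamma> constant_on {0..1}")
    case True
    then show ?thesis
      using xy \<open>0 < \<epsilon>\<close> by (auto simp: standard_param_def constant_on_def)
  next
    case False
    have \<gamma>: "path \<gamma>"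
      using \<gamma>\<F> \<F> path_classesD(1) by blast
    obtain s where s: "s \<in> {0..1}" "len \<gamma> 0 s = x * len \<gamma> 0 1" "standard_param \<gamma> x = \<gamma> s"
      using standard_param_cases[OF \<gamma> False xy(1)] by blast
    obtain t where t: "t \<in> {0..1}" "len \<gamma> 0 t = y * len \<gamma> 0 1" "standard_param \<gamma> y = \<gamma> t"
      using standard_param_cases[OF \<gamma> False xy(2)] by blast
    have far: "d \<le> len \<gamma> 0 r - len \<gamma> 0 q"
      if "q \<in> {0..1}" "r \<in> {0..1}" "q \<le> r" "e \<le> dist (\<gamma> r) (\<gamma> q)" for q r
      using len_increment[OF \<gamma> few[OF \<gamma>\<F>] e(1,2), of q r] that unfolding d_def by simp
    have "\<bar>len \<gamma> 0 t - len \<gamma> 0 s\<bar> = \<bar>y - x\<bar> * len \<gamma> 0 1"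
      using len_bounds(1)[OF \<gamma>, of 1] s(2) t(2) by (simp add: abs_mult flip: left_diff_distrib)
    also have "\<dots> \<le> \<bar>y - x\<bar> * 2"
      using len_bounds(2)[OF \<gamma>, of 1] by (intro mult_left_mono) auto
    also have "\<dots> < d"
      using xy(3) by (simp add: dist_real_def)
    finally have "\<bar>len \<gamma> 0 t - len \<gamma> 0 s\<bar> < d" .
    then have "dist (\<gamma> t) (\<gamma> s) < e"
      using far[of s t] far[of t s] s(1) t(1) by (cases "s \<le> t") (force simp: dist_commute)+
    then show ?thesis
      using s(3) t(3) e(3) by simp
  qed
  show "\<exists>\<delta>>0. \<forall>f\<in>{standard_param \<gamma> |\<gamma>. \<gamma> \<in> \<Union>\<F>}. \<forall>x\<in>{0..1}. \<forall>y\<in>{0..1}.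
      dist y x < \<delta> \<longrightarrow> dist (f y) (f x) < \<epsilon>"
  proof (intro exI[of _ "d / 2"] conjI ballI impI)
    show "0 < d / 2"
      using \<open>0 < d\<close> by simp
    fix f :: "real \<Rightarrow> 'a" and x y :: real
    assume f: "f \<in> {standard_param \<gamma> |\<gamma>. \<gamma> \<in> \<Union>\<F>}"
      and xy: "x \<in> {0..1}" "y \<in> {0..1}" "dist y x < d / 2"
    then obtain \<gamma> where "\<gamma> \<in> \<Union>\<F>" "f = standard_param \<gamma>"
      by blast
    then show "dist (f y) (f x) < \<epsilon>"
      using close xy by simp
  qed
qed

theorem theorem12:
  fixes \<F> :: "(real \<Rightarrow> real ^ 'n) set set"
  assumes "CARD('n) \<ge> 2"
    and "\<F> \<subseteq> path_classes"
  shows "(uniformly_bounded_oscillation \<F> \<longrightarrow>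
            equicontinuous_on {0..1} {standard_param \<gamma> |\<gamma>. \<gamma> \<in> \<Union>\<F>}) \<and>
         ((\<exists>r. (\<forall>X\<in>\<F>. r X \<in> X) \<and> equicontinuous_on {0..1} (r ` \<F>)) \<longrightarrow>
            uniformly_bounded_oscillation \<F>)"
  using bounded_oscillation_imp_equicontinuous[OF assms(2)]
    equicontinuous_representatives_imp_bounded_oscillation[OF assms(2)] by blast

end
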